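(* Let $r\geq 1$ be an integer, and let $k$ run through odd positive integers with $k\to+\infty$. Then: (i) if $r$ is odd, $$\zeta_r(-k)\sim\frac{1}{r}\zeta(-rk)\sim(-1)^{(rk+1)/2}\cdot\frac{2k^{1/2}}{\sqrt{2\pi}}\cdot r^{rk-1/2}\left(\frac{k}{2\pi e}\right)^{rk};$$ (ii) $$\zeta_2(-k)=\frac{1}{2}\zeta(-k)^2\sim\frac{k}{\pi}\left(\frac{k}{2\pi e}\right)^{2k};$$ (iii) if $r\geq 4$ is even, $$\zeta_r(-k)\sim\frac{1}{r-1}\zeta(-k)\zeta(-(r-1)k)\sim(-1)^{(r/2)-1}\cdot\frac{2k}{\pi}\cdot(r-1)^{(r-1)k-1/2}\left(\frac{k}{2\pi e}\right)^{rk}.$$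
   Context: For an integer $r\geq 1$ and $s\in\mathbb{C}$, $\zeta_r(s)=\zeta_r(s,s,\ldots,s)=\sum_{1\leq m_1<m_2<\cdots<m_r}(m_1m_2\cdots m_r)^{-s}$ is the Euler–Zagier $r$-fold zeta-function with all arguments equal; the series converges absolutely for $\Re s>1$, and $\zeta_r(s)$ is understood via its meromorphic continuation to $\mathbb{C}$. Here $\zeta=\zeta_1$ is the Riemann zeta-function. The notation $f\sim g$ means $f/g\to 1$. *)

theory Defs
  imports "HOL-Complex_Analysis.Complex_Analysis" "HOL-Library.Landau_Symbols"
begin

text \<open>The tuples \<open>1 \<le> m\<^sub>1 < m\<^sub>2 < \<dots> < m\<^sub>r\<close> of the summation are represented by strictly
  increasing lists of positive integers of length \<open>r\<close>.\<close>

definition euler_zagier_series :: "nat \<Rightarrow> complex \<Rightarrow> complex" where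
  "euler_zagier_series r s =
     (\<Sum>\<^sub>\<infinity>ms | length ms = r \<and> sorted_wrt (<) ms \<and> (\<forall>m\<in>set ms. m \<ge> (1::nat)).
        of_nat (prod_list ms) powr (-s))"

text \<open>The meromorphic continuation to the whole plane. The library predicate
  \<^const>\<open>nicely_meromorphic_on\<close> requires the function to be continuous at all points that are
  not poles and to take the value 0 at its poles, which makes the continuation unique as a total
  function (see the lemma below).\<close>

definition euler_zagier_zeta :: "nat \<Rightarrow> complex \<Rightarrow> complex" where
  "euler_zagier_zeta r =
     (THE f. f nicely_meromorphic_on UNIV \<and> (\<forall>s. Re s > 1 \<longrightarrow> f s = euler_zagier_series r s))"

abbreviation riemann_zeta :: "complex \<Rightarrow> complex" where
  "riemann_zeta \<equiv> euler_zagier_zeta 1"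

abbreviation odd_at_top :: "nat filter" where
  "odd_at_top \<equiv> inf at_top (principal {k. odd k})"

lemma nicely_meromorphic_on_UNIV_unique:
  assumes f: "f nicely_meromorphic_on UNIV" and g: "g nicely_meromorphic_on UNIV"
    and eq: "\<And>s. Re s > 1 \<Longrightarrow> f s = g s"
  shows "f = g"
proof
  fix z :: complex
  define h where "h = remove_sings (\<lambda>s. f s - g s)"
  have fm: "f meromorphic_on UNIV" and gm: "g meromorphic_on UNIV"
    using f g by (auto simp: nicely_meromorphic_on_def)
  have hm: "h nicely_meromorphic_on UNIV"
    unfolding h_def by (intro remove_sings_nicely_meromorphic meromorphic_intros fm gm)
  have "eventually (\<lambda>s. Re s > 1) (nhds (2::complex))"
    by (intro eventually_nhds_in_open[of "{s. Re s > 1}", simplified] open_halfspace_Re_gt) simp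
  hence "eventually (\<lambda>s. f s - g s = 0) (nhds (2::complex))"
    by eventually_elim (simp add: eq)
  hence ev: "eventually (\<lambda>w. eventually (\<lambda>s. f s - g s = 0) (nhds w)) (nhds (2::complex))"
    by (simp add: eventually_eventually)
  have "eventually (\<lambda>w. h w = 0) (nhds (2::complex))"
    using ev
  proof eventually_elim
    case (elim w)
    hence "eventually (\<lambda>s. f s - g s = 0) (at w)"
      by (simp add: eventually_at_filter eventually_mono)
    hence "((\<lambda>s. f s - g s) \<longlongrightarrow> 0) (at w)" by (rule tendsto_eventually)
    thus ?case unfolding h_def by (rule remove_sings_eqI)
  qed
  hence "eventually (\<lambda>w. h w = 0) (at (2::complex))"
    by (simp add: eventually_at_filter eventually_mono)
  hence "frequently (\<lambda>w. h w = 0) (at (2::complex))"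
    by (intro eventually_frequently) auto
  hence h0: "h w = 0" for w
    using frequently_eq_meromorphic_imp_constant[OF _ hm, of 0 2 w] by auto
  have "eventually (\<lambda>s. h s = f s - g s) (at z)"
    unfolding h_def
    by (intro eventually_remove_sings_eq_at meromorphic_on_isolated_singularity
              meromorphic_intros meromorphic_on_subset[OF fm] meromorphic_on_subset[OF gm]) auto
  hence ev: "eventually (\<lambda>s. f s = g s) (at z)"
    by eventually_elim (simp add: h0)
  have pole: "is_pole f z \<longleftrightarrow> is_pole g z"
    by (rule is_pole_cong[OF ev refl])
  have lim: "(f \<longlongrightarrow> c) (at z) \<longleftrightarrow> (g \<longlongrightarrow> c) (at z)" for c
    by (rule tendsto_cong[OF ev])
  show "f z = g z"
  proof (cases "is_pole f z")
    case True
    have "\<not> f \<midarrow>z\<rightarrow> f z" "\<not> g \<midarrow>z\<rightarrow> g z"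
      using True pole is_pole_def not_tendsto_and_filterlim_at_infinity trivial_limit_at by blast+
    hence "f z = 0" "g z = 0"
      using f g unfolding nicely_meromorphic_on_def by blast+
    thus ?thesis by simp
  next
    case False
    hence "f \<midarrow>z\<rightarrow> f z" "g \<midarrow>z\<rightarrow> g z"
      using f g pole by (auto simp: nicely_meromorphic_on_def)
    thus ?thesis using lim tendsto_unique trivial_limit_at by blast
  qed
qed

lemma euler_zagier_zeta_eqI:
  assumes "f nicely_meromorphic_on UNIV" "\<And>s. Re s > 1 \<Longrightarrow> f s = euler_zagier_series r s"
  shows "euler_zagier_zeta r = f"
  unfolding euler_zagier_zeta_def
  using assms by (intro the_equality) (auto intro: nicely_meromorphic_on_UNIV_unique)

end

theory Submission
  imports Defs "HOL-Real_Asymp.Real_Asymp"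
begin

text \<open>
  The numbers \<open>\<zeta>\<^sub>r(s)\<close> and \<open>\<zeta>(j s)\<close> are the elementary symmetric functions and the power sums of
  \<open>m\<^sup>-\<^sup>s\<close>, so Newton's identities express \<open>\<zeta>\<^sub>r\<close> recursively through \<open>\<zeta>(s), \<dots>, \<zeta>(r s)\<close>; this gives the
  continuation and remains valid at \<open>s = -k\<close>. For odd \<open>k\<close> the terms with even \<open>j\<close> vanish, since
  \<open>\<zeta>(-j k) = 0\<close>. The remaining products of values \<open>\<zeta>(-j k)\<close> with \<open>j\<close> odd grow like
  \<open>(\<Prod>j j\<^sup>j)\<^sup>k\<close>, where the \<open>j\<close> sum up to \<open>r\<close>. As \<open>j log j\<close> is convex, the dominant products are
  \<open>\<zeta>(-r k)\<close> for odd \<open>r\<close> and \<open>\<zeta>(-k) \<zeta>(-(r-1) k)\<close> for even \<open>r\<close>. The size of \<open>\<zeta>(-n)\<close> follows from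
  \<open>\<zeta>(-n) = (-1)\<^sup>n n! b\<^sub>n\<close>, with \<open>b\<^sub>n\<close> the Taylor coefficients of \<open>1 / (e\<^sup>t - 1) - 1 / t\<close>, and from
  Stirling's formula.
\<close>

section \<open>Newton's identities\<close>

text \<open>The even case hides a tie. In Newton's sum for r \<zeta>_r(-k), both the term
  \<zeta>(-k) \<zeta>(-(r-1)k) with i = 1 and the term \<zeta>_(r-1)(-k) \<zeta>(-k) with i = r - 1
  have maximal growth, and by the odd case the second is asymptotically 1/(r-1) times the first.
  Their sum carries the factor r/(r-1), and division by r leaves 1/(r-1). For r = 2 the two terms
  are the same one, which is why that case stands apart and is exact. Every other term vanishes or
  loses by an exponential factor, so upper bounds that are generous in powers of k suffice for it.
  Newton's recursion may be evaluated at s = -k because the poles of \<zeta>(j s) lie at s = 1/j,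
  outside the half-plane Re s \<le> 0.\<close>

definition strict_lists :: "nat \<Rightarrow> nat \<Rightarrow> nat list set" where
  "strict_lists r N = {ms. length ms = r \<and> sorted_wrt (<) ms \<and> set ms \<subseteq> {1..N}}"

text \<open>The bound \<open>N\<close> on the entries makes the symmetric functions finite sums, for
  which Newton's identities are plain algebra; the limit in \<open>N\<close> comes afterwards. The
  ring is general because complex weights and their real norms both occur.\<close>

definition elem_sym :: "(nat \<Rightarrow> 'a) \<Rightarrow> nat \<Rightarrow> nat \<Rightarrow> 'a :: comm_ring_1" where
  "elem_sym f r N = (\<Sum>ms\<in>strict_lists r N. prod_list (map f ms))"

lemma finite_strict_lists [intro]: "finite (strict_lists r N)"
  by (rule finite_subset[OF _ finite_lists_length_eq[of "{1..N}" r]]) (auto simp: strict_lists_def)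

lemma strict_lists_0: "strict_lists 0 N = {[]}"
  by (auto simp: strict_lists_def)

lemma strict_lists_Suc_0: "strict_lists (Suc r) 0 = {}"
  by (auto simp: strict_lists_def)

lemma strict_lists_Suc_Suc:
  "strict_lists (Suc r) (Suc N) =
     strict_lists (Suc r) N \<union> (\<lambda>ms. ms @ [Suc N]) ` strict_lists r N"
proof (intro equalityI subsetI)
  fix ms assume ms: "ms \<in> strict_lists (Suc r) (Suc N)"
  hence "ms \<noteq> []" by (auto simp: strict_lists_def)
  then obtain ns x where ns: "ms = ns @ [x]" by (metis rev_exhaust)
  show "ms \<in> strict_lists (Suc r) N \<union> (\<lambda>ms. ms @ [Suc N]) ` strict_lists r N"
  proof (cases "x = Suc N")
    case True
    with ms ns show ?thesis
      by (intro UnI2 image_eqI[of _ _ ns]) (force simp: strict_lists_def sorted_wrt_append)+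
  next
    case False
    with ms ns show ?thesis
      by (intro UnI1) (force simp: strict_lists_def sorted_wrt_append)
  qed
qed (force simp: strict_lists_def sorted_wrt_append)

lemma elem_sym_0 [simp]: "elem_sym f 0 N = 1"
  by (simp add: elem_sym_def strict_lists_0)

lemma elem_sym_Suc_0 [simp]: "elem_sym f (Suc r) 0 = 0"
  by (simp add: elem_sym_def strict_lists_Suc_0)

lemma elem_sym_Suc_Suc:
  "elem_sym f (Suc r) (Suc N) = elem_sym f (Suc r) N + f (Suc N) * elem_sym f r N"
proof -
  have "elem_sym f (Suc r) (Suc N) = elem_sym f (Suc r) N +
          (\<Sum>ms\<in>(\<lambda>ms. ms @ [Suc N]) ` strict_lists r N. prod_list (map f ms))"
    unfolding elem_sym_def strict_lists_Suc_Suc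
    by (intro sum.union_disjoint finite_imageI finite_strict_lists) (auto simp: strict_lists_def)
  also have "(\<Sum>ms\<in>(\<lambda>ms. ms @ [Suc N]) ` strict_lists r N. prod_list (map f ms)) =
               f (Suc N) * elem_sym f r N"
    by (subst sum.reindex) (auto simp: inj_on_def elem_sym_def sum_distrib_left mult.commute)
  finally show ?thesis .
qed

lemma elem_sym_1: "elem_sym f (Suc 0) N = (\<Sum>m=1..N. f m)"
  by (induction N) (simp_all add: elem_sym_Suc_Suc)

text \<open>Compares coefficients in the logarithmic derivative of \<open>\<Prod>m\<le>N. 1 + f m * X\<close>.\<close>

lemma newton_identity:
  fixes f :: "nat \<Rightarrow> 'a :: comm_ring_1"
  shows "of_nat (Suc n) * elem_sym f (Suc n) N =
           (\<Sum>i\<le>n. elem_sym f i N * ((-1) ^ (n - i) * (\<Sum>m=1..N. f m ^ Suc (n - i))))"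
proof -
  define E where "E = (\<lambda>N. Abs_fps (\<lambda>r. elem_sym f r N))"
  \<comment> \<open>\<open>G c\<close> is c / (1 + c X), the logarithmic derivative of the factor 1
    + c X. The argument only multiplies and never divides, so any commutative ring will do.\<close>
  define G where "G = (\<lambda>c::'a. Abs_fps (\<lambda>j. (-1) ^ j * c ^ Suc j))"
  have E_Suc: "E (Suc N) = E N * (1 + fps_const (f (Suc N)) * fps_X)" for N
  proof -
    have "E (Suc N) = E N + fps_const (f (Suc N)) * (fps_X * E N)"
    proof (rule fps_ext)
      fix r show "fps_nth (E (Suc N)) r = fps_nth (E N + fps_const (f (Suc N)) * (fps_X * E N)) r"
        by (cases r) (simp_all add: E_def elem_sym_Suc_Suc)
    qed
    thus ?thesis by (simp add: algebra_simps)
  qed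
  have G: "(1 + fps_const c * fps_X) * G c = fps_const c" for c
  proof -
    have "G c + fps_const c * (fps_X * G c) = fps_const c"
    proof (rule fps_ext)
      fix r show "fps_nth (G c + fps_const c * (fps_X * G c)) r = fps_nth (fps_const c) r"
        by (cases r) (simp_all add: G_def)
    qed
    thus ?thesis by (simp add: algebra_simps)
  qed
  have "fps_deriv (E N) = E N * (\<Sum>m=1..N. G (f m))"
  proof (induction N)
    case 0
    have "E 0 = 1"
    proof (rule fps_ext)
      fix r show "fps_nth (E 0) r = fps_nth 1 r"
        by (cases r) (simp_all add: E_def)
    qed
    thus ?case by simp
  next
    case (Suc N)
    define c where "c = f (Suc N)"
    define U where "U = 1 + fps_const c * fps_X"
    have E_U: "E (Suc N) = E N * U" and GU: "U * G c = fps_const c"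
      by (simp_all add: E_Suc U_def c_def G)
    have "fps_deriv U = fps_const c" by (simp add: U_def)
    hence "fps_deriv (E (Suc N)) = fps_deriv (E N) * U + E N * (U * G c)"
      by (simp add: E_U GU)
    also have "\<dots> = E (Suc N) * (\<Sum>m=1..Suc N. G (f m))"
      by (simp add: Suc.IH E_U c_def algebra_simps)
    finally show ?case .
  qed
  hence "fps_nth (fps_deriv (E N)) n = fps_nth (E N * (\<Sum>m=1..N. G (f m))) n"
    by simp
  also have "\<dots> = (\<Sum>i\<le>n. fps_nth (E N) i * (\<Sum>m=1..N. fps_nth (G (f m)) (n - i)))"
    by (simp only: fps_mult_nth fps_sum_nth atLeast0AtMost)
  finally show ?thesis
    by (simp add: E_def G_def sum_distrib_left)
qed

section \<open>Passage to infinite symmetric functions\<close>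

lemma elem_sym_le_power_sum:
  fixes f :: "nat \<Rightarrow> real"
  assumes "\<And>m. f m \<ge> 0"
  shows "elem_sym f r N \<le> (\<Sum>m=1..N. f m) ^ r"
proof (induction N arbitrary: r)
  case 0
  show ?case by (cases r) auto
next
  case (Suc N)
  define P where "P = (\<Sum>m=1..N. f m)"
  have P: "P \<ge> 0" unfolding P_def by (intro sum_nonneg assms)
  show ?case
  proof (cases r)
    case (Suc r')
    have "elem_sym f r (Suc N) \<le> P ^ Suc r' + f (Suc N) * P ^ r'"
      unfolding Suc elem_sym_Suc_Suc P_def by (intro add_mono mult_left_mono Suc.IH assms)
    also have "\<dots> = (P + f (Suc N)) * P ^ r'" by (simp add: algebra_simps)
    also have "\<dots> \<le> (P + f (Suc N)) * (P + f (Suc N)) ^ r'"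
      using P assms by (intro mult_left_mono power_mono) auto
    finally show ?thesis by (simp add: Suc P_def)
  qed auto
qed

text \<open>The sets \<open>strict_lists r N\<close> increase and eventually contain any given
  finite set of admissible lists, so sums over them converge to the unconditional sum. The latter
  exists because every finite sum of norms is at most the r-th power of the full sum of norms of
  \<open>f\<close>.\<close>

lemma elem_sym_tendsto_infsum:
  fixes f :: "nat \<Rightarrow> complex"
  assumes "summable (\<lambda>m. norm (f (Suc m)))"
  shows "(\<lambda>N. elem_sym f r N) \<longlonglongrightarrow>
     (\<Sum>\<^sub>\<infinity>ms | length ms = r \<and> sorted_wrt (<) ms \<and> (\<forall>m\<in>set ms. m \<ge> (1::nat)). prod_list (map f ms))"
proof -
  define A where "A = {ms. length ms = r \<and> sorted_wrt (<) ms \<and> (\<forall>m\<in>set ms. m \<ge> (1::nat))}"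
  have sub: "strict_lists r N \<subseteq> A" for N
    by (auto simp: strict_lists_def A_def)
  have bounded: "\<exists>N. F \<subseteq> strict_lists r N" if "finite F" "F \<subseteq> A" for F
  proof -
    have "finite (\<Union>(set ` F))" using that by auto
    then obtain N where "\<Union>(set ` F) \<subseteq> {..N}" by (metis finite_nat_iff_bounded_le)
    hence "ms \<in> strict_lists r N" if "ms \<in> F" for ms
      using that \<open>F \<subseteq> A\<close> by (auto simp: strict_lists_def A_def Suc_le_eq subset_iff)
    thus ?thesis by blast
  qed
  have norm_prod: "norm (prod_list (map f ms)) = prod_list (map (\<lambda>m. norm (f m)) ms)" for ms
    by (induction ms) (auto simp: norm_mult)
  define S where "S = (\<Sum>m. norm (f (Suc m)))"
  have "(\<lambda>ms. norm (prod_list (map f ms))) summable_on A"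
  proof (rule nonneg_bdd_above_summable_on)
    have "sum (\<lambda>ms. norm (prod_list (map f ms))) F \<le> S ^ r" if F: "finite F" "F \<subseteq> A" for F
    proof -
      from bounded[OF F] obtain N where N: "F \<subseteq> strict_lists r N" by blast
      have "sum (\<lambda>ms. norm (prod_list (map f ms))) F \<le>
              sum (\<lambda>ms. norm (prod_list (map f ms))) (strict_lists r N)"
        using N by (intro sum_mono2) auto
      also have "\<dots> = elem_sym (\<lambda>m. norm (f m)) r N"
        by (simp add: elem_sym_def norm_prod)
      also have "\<dots> \<le> (\<Sum>m=1..N. norm (f m)) ^ r"
        by (intro elem_sym_le_power_sum) auto
      also have "(\<Sum>m=1..N. norm (f m)) = (\<Sum>m<N. norm (f (Suc m)))"
        by (rule sum.reindex_bij_witness[of _ Suc "\<lambda>m. m - 1"]) auto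
      also have "\<dots> ^ r \<le> S ^ r"
        unfolding S_def using assms by (intro power_mono sum_le_suminf sum_nonneg) auto
      finally show ?thesis .
    qed
    thus "bdd_above (sum (\<lambda>ms. norm (prod_list (map f ms))) ` {F. F \<subseteq> A \<and> finite F})"
      by (intro bdd_aboveI[of _ "S ^ r"]) auto
  qed auto
  hence "(\<lambda>ms. prod_list (map f ms)) summable_on A"
    by (rule abs_summable_summable)
  hence "((\<lambda>ms. prod_list (map f ms)) has_sum (\<Sum>\<^sub>\<infinity>ms\<in>A. prod_list (map f ms))) A"
    by simp
  hence "(sum (\<lambda>ms. prod_list (map f ms)) \<longlongrightarrow> (\<Sum>\<^sub>\<infinity>ms\<in>A. prod_list (map f ms)))
           (finite_subsets_at_top A)"
    by (simp add: has_sum_def)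
  moreover have "filterlim (strict_lists r) (finite_subsets_at_top A) sequentially"
    unfolding filterlim_finite_subsets_at_top
  proof (intro allI impI)
    fix F assume "finite F \<and> F \<subseteq> A"
    then obtain N where N: "F \<subseteq> strict_lists r N" using bounded by blast
    have "strict_lists r N \<subseteq> strict_lists r M" if "M \<ge> N" for M
      using that by (auto simp: strict_lists_def)
    with N sub show "\<forall>\<^sub>F M in sequentially. finite (strict_lists r M) \<and> F \<subseteq> strict_lists r M \<and> strict_lists r M \<subseteq> A"
      by (intro eventually_mono[OF eventually_ge_at_top[of N]]) blast
  qed
  ultimately show ?thesis
    unfolding A_def elem_sym_def by (rule filterlim_compose)
qed

lemma euler_zagier_series_tendsto:
  assumes "Re s > 1"
  shows "(\<lambda>N. elem_sym (\<lambda>m. of_nat m powr (-s)) r N) \<longlonglongrightarrow> euler_zagier_series r s"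
proof -
  have "summable (\<lambda>m. real (Suc m) powr (- Re s))"
    using assms by (subst summable_Suc_iff) (simp add: summable_real_powr_iff)
  hence "summable (\<lambda>m. norm (of_nat (Suc m) powr (-s) :: complex))"
    by (simp add: norm_powr_real_powr)
  from elem_sym_tendsto_infsum[OF this] 
  have "(\<lambda>N. elem_sym (\<lambda>m. of_nat m powr (-s)) r N) \<longlonglongrightarrow>
     (\<Sum>\<^sub>\<infinity>ms | length ms = r \<and> sorted_wrt (<) ms \<and> (\<forall>m\<in>set ms. m \<ge> (1::nat)).
         prod_list (map (\<lambda>m. of_nat m powr (-s)) ms))" .
  moreover have "of_nat (prod_list ms) powr (-s) = prod_list (map (\<lambda>m. of_nat m powr (-s)) ms)" for ms
  proof (induction ms)
    case (Cons m ms)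
    \<comment> \<open>Complex powers are multiplicative here because both bases are nonnegative
      reals.\<close>
    have "of_nat (m * prod_list ms) powr (-s) = of_nat m powr (-s) * of_nat (prod_list ms) powr (-s)"
      using powr_times_real[of "of_nat m" "of_nat (prod_list ms)" "-s"] by simp
    thus ?case using Cons.IH by simp
  qed auto
  ultimately show ?thesis by (simp add: euler_zagier_series_def)
qed

lemma euler_zagier_series_0: "euler_zagier_series 0 s = 1"
proof -
  have "{ms. length ms = 0 \<and> sorted_wrt (<) ms \<and> (\<forall>m\<in>set ms. m \<ge> (1::nat))} = {[]}"
    by auto
  thus ?thesis by (simp add: euler_zagier_series_def)
qed

lemma euler_zagier_series_1_sums:
  assumes "Re s > 1"
  shows "(\<lambda>n. of_nat (Suc n) powr (-s)) sums euler_zagier_series 1 s"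
proof -
  have "(\<Sum>m=1..N. of_nat m powr (-s)) = (\<Sum>n<N. of_nat (Suc n) powr (-s) :: complex)" for N
    by (rule sum.reindex_bij_witness[of _ Suc "\<lambda>m. m - 1"]) auto
  with euler_zagier_series_tendsto[OF assms, of 1] show ?thesis
    by (simp add: elem_sym_1 sums_def)
qed

lemma Re_of_nat_Suc_mult_gt_1:
  assumes "Re s > 1"
  shows "Re (of_nat (Suc j) * s) > 1"
proof -
  have "1 * Re s \<le> real (Suc j) * Re s" using assms by (intro mult_right_mono) auto
  also have "\<dots> = Re (of_nat (Suc j) * s)" by simp
  finally show ?thesis using assms by linarith
qed

lemma euler_zagier_series_newton:
  assumes "Re s > 1"
  shows "of_nat (Suc n) * euler_zagier_series (Suc n) s =
     (\<Sum>i\<le>n. euler_zagier_series i s *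
        ((-1) ^ (n - i) * euler_zagier_series 1 (of_nat (Suc (n - i)) * s)))"
proof -
  \<comment> \<open>The condition \<open>j > 0\<close> matters at \<open>m = 0\<close>: there
    \<open>powr\<close> gives 0, while an empty power would be 1.\<close>
  have pow: "(of_nat m powr (-s)) ^ j = of_nat m powr (-(of_nat j * s))" if "j > 0" for m j :: nat
    using that by (cases "m = 0") (simp_all add: powr_def exp_of_nat_mult [symmetric] mult_ac)
  have lim: "(\<lambda>N. \<Sum>m=1..N. (of_nat m powr (-s)) ^ Suc j) \<longlonglongrightarrow>
               euler_zagier_series 1 (of_nat (Suc j) * s)" for j
  proof -
    from euler_zagier_series_tendsto[OF Re_of_nat_Suc_mult_gt_1[OF assms, of j], of 1] show ?thesis
      by (simp only: pow elem_sym_1 One_nat_def zero_less_Suc)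
  qed
  have "(\<lambda>N. \<Sum>i\<le>n. elem_sym (\<lambda>m. of_nat m powr (-s)) i N *
          ((-1) ^ (n - i) * (\<Sum>m=1..N. (of_nat m powr (-s)) ^ Suc (n - i)))) \<longlonglongrightarrow>
        (\<Sum>i\<le>n. euler_zagier_series i s *
          ((-1) ^ (n - i) * euler_zagier_series 1 (of_nat (Suc (n - i)) * s)))"
    by (intro tendsto_intros lim euler_zagier_series_tendsto assms)
  moreover have "(\<lambda>N. of_nat (Suc n) * elem_sym (\<lambda>m. of_nat m powr (-s)) (Suc n) N) \<longlonglongrightarrow>
                   of_nat (Suc n) * euler_zagier_series (Suc n) s"
    by (intro tendsto_intros euler_zagier_series_tendsto assms)
  ultimately show ?thesis
    unfolding newton_identity by (rule LIMSEQ_unique [symmetric])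
qed

section \<open>The kernel of the Mellin integral\<close>

text \<open>The value \<open>-1/2\<close> removes the singularity at 0; the coefficients are \<open>B\<^sub>n\<^sub>+\<^sub>1 / (n + 1)!\<close>.\<close>

definition zeta_kernel :: "complex \<Rightarrow> complex" where
  "zeta_kernel t = (if t = 0 then -1/2 else 1 / (exp t - 1) - 1 / t)"

definition zeta_coeff :: "nat \<Rightarrow> complex" where
  "zeta_coeff n = (deriv ^^ n) zeta_kernel 0 / fact n"

lemma exp_neq_1_ball:
  assumes "norm t < 2 * pi" "t \<noteq> 0"
  shows "exp t \<noteq> (1 :: complex)"
proof
  assume "exp t = 1"
  then obtain n :: int where n: "Re t = 0" "Im t = of_int (2 * n) * pi"
    by (auto simp: exp_eq_1)
  have "\<bar>real_of_int (2 * n)\<bar> * pi < 2 * pi"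
    using assms(1) n by (simp add: cmod_eq_Im abs_mult)
  hence "\<bar>real_of_int n\<bar> < 1" by (simp add: abs_mult)
  hence "n = 0" by linarith
  with n assms(2) show False by (simp add: complex_eq_iff)
qed

text \<open>Over the common denominator t (e^t - 1) the numerator is t - (e^t - 1). Both vanish to
  order exactly 2 at 0, with leading coefficients 1 and -1/2, so the quotient of power series exists
  and has constant term -1/2.\<close>

lemma zeta_kernel_analytic_0: "zeta_kernel analytic_on {0}"
proof -
  define F where "F = fps_X - (fps_exp 1 - 1 :: complex fps)"
  define G where "G = fps_X * (fps_exp 1 - 1 :: complex fps)"
  have G_nth: "fps_nth G 0 = 0" "fps_nth G 1 = 0" "fps_nth G 2 = 1"
    by (simp_all add: G_def numeral_2_eq_2)
  have sG: "subdegree G = 2"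
    by (rule subdegreeI) (use G_nth in \<open>auto simp: less_2_cases_iff\<close>)
  have F_nth: "fps_nth F 0 = 0" "fps_nth F 1 = 0" "fps_nth F 2 = -1/2"
    by (simp_all add: F_def numeral_2_eq_2)
  have sF: "subdegree F = 2"
    by (rule subdegreeI) (use F_nth in \<open>auto simp: less_2_cases_iff\<close>)
  have "(\<lambda>t. if t = 0 then -1/2 else (t - (exp t - 1)) / (t * (exp t - 1)))
          has_fps_expansion (F / G)"
  proof (rule has_fps_expansion_divide)
    show "(\<lambda>t. t - (exp t - 1)) has_fps_expansion F" "(\<lambda>t. t * (exp t - 1)) has_fps_expansion G"
      unfolding F_def G_def by (intro fps_expansion_intros)+
  qed (use sF sG G_nth F_nth in auto)
  hence "(\<lambda>t. if t = 0 then -1/2 else (t - (exp t - 1)) / (t * (exp t - 1))) analytic_on {0 :: complex}"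
    by (rule has_fps_expansion_imp_analytic_0)
  also have "?this \<longleftrightarrow> zeta_kernel analytic_on {0}"
  proof (rule analytic_at_cong)
    have "\<forall>\<^sub>F t in nhds 0. t \<in> ball (0::complex) (2 * pi)"
      by (intro eventually_nhds_in_open) auto
    thus "\<forall>\<^sub>F t in nhds 0. (if t = 0 then -1/2 else (t - (exp t - 1)) / (t * (exp t - 1))) = zeta_kernel t"
    proof eventually_elim
      case (elim t)
      show ?case
      proof (cases "t = 0")
        case False
        hence "exp t - 1 \<noteq> 0" using exp_neq_1_ball[of t] elim by auto
        with False show ?thesis by (simp add: zeta_kernel_def divide_simps)
      qed (auto simp: zeta_kernel_def)
    qed
  qed auto
  finally show ?thesis .
qed

lemma zeta_kernel_analytic:
  assumes "t = 0 \<or> exp t \<noteq> 1"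
  shows "zeta_kernel analytic_on {t}"
proof (cases "t = 0")
  case False
  have "(\<lambda>t. 1 / (exp t - 1) - 1 / t) analytic_on {t}"
    using assms False by (auto intro!: analytic_intros)
  also have "?this \<longleftrightarrow> zeta_kernel analytic_on {t}"
    by (rule analytic_at_cong[OF eventually_mono[OF t1_space_nhds[OF False]]])
       (auto simp: zeta_kernel_def)
  finally show ?thesis .
qed (auto intro: zeta_kernel_analytic_0)

lemma zeta_kernel_holomorphic: "zeta_kernel holomorphic_on ball 0 (2 * pi)"
proof -
  have "zeta_kernel analytic_on (\<Union>t\<in>ball 0 (2 * pi). {t})"
    unfolding analytic_on_UN using exp_neq_1_ball by (auto intro!: zeta_kernel_analytic)
  thus ?thesis by (intro analytic_imp_holomorphic) simp
qed

lemma zeta_kernel_sums: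
  assumes "norm t < 2 * pi"
  shows "(\<lambda>n. zeta_coeff n * t ^ n) sums zeta_kernel t"
  using holomorphic_power_series[OF zeta_kernel_holomorphic, of t] assms
  by (simp add: zeta_coeff_def)

text \<open>Convergence at t = 2 < 2\<pi> forces absolute convergence at t = 1. This is the majorant
  for integrating the power series termwise over (0,1).\<close>

lemma summable_norm_zeta_coeff: "summable (\<lambda>n. norm (zeta_coeff n))"
proof -
  have "summable (\<lambda>n. zeta_coeff n * 2 ^ n)"
    using zeta_kernel_sums[of 2] pi_gt3 by (simp add: sums_iff)
  from powser_insidea[OF this, of 1] show ?thesis by simp
qed

lemma zeta_coeff_unique:
  assumes "0 < r" "\<And>t. norm t < r \<Longrightarrow> (\<lambda>n. c n * t ^ n) sums zeta_kernel t"
  shows "zeta_coeff n = c n"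
proof -
  have "\<forall>\<^sub>F t in nhds 0. t \<in> ball (0::complex) r"
    using assms(1) by (intro eventually_nhds_in_open) auto
  hence "zeta_kernel has_fps_expansion Abs_fps c"
    by (intro has_fps_expansionI) (auto elim!: eventually_mono intro!: assms(2))
  from fps_nth_fps_expansion[OF this, of n] show ?thesis
    by (simp add: zeta_coeff_def)
qed

lemma zeta_kernel_minus:
  assumes "norm t < 2 * pi"
  shows "zeta_kernel (-t) = -1 - zeta_kernel t"
proof (cases "t = 0")
  case False
  with exp_neq_1_ball[OF assms] have "exp t \<noteq> 1" "exp t \<noteq> 0" by auto
  thus ?thesis using False by (simp add: zeta_kernel_def exp_minus field_simps)
qed (simp add: zeta_kernel_def)

text \<open>The kernel plus 1/2 is odd, so of the even coefficients only the constant one survives.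
  This is the source of the trivial zeros of \<zeta>.\<close>

lemma zeta_coeff_even:
  assumes "even n" "n > 0"
  shows "zeta_coeff n = 0"
proof -
  have "zeta_coeff n = (\<lambda>n. - ((-1) ^ n * zeta_coeff n) - (if n = 0 then 1 else 0)) n"
  proof (rule zeta_coeff_unique)
    fix t :: complex assume t: "norm t < 2 * pi"
    have "(\<lambda>n. - (zeta_coeff n * (-t) ^ n) - (if n = 0 then 1 else 0)) sums (- zeta_kernel (-t) - 1)"
      by (intro sums_diff sums_minus zeta_kernel_sums) (use t sums_single[of 0 "\<lambda>_. 1"] in auto)
    also have "(\<lambda>n. - (zeta_coeff n * (-t) ^ n) - (if n = 0 then 1 else 0)) =
                 (\<lambda>n. (- ((-1) ^ n * zeta_coeff n) - (if n = 0 then 1 else 0)) * t ^ n)"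
      by (auto simp: fun_eq_iff power_minus[of t] algebra_simps)
    also have "- zeta_kernel (-t) - 1 = zeta_kernel t"
      using t by (simp add: zeta_kernel_minus)
    finally show "(\<lambda>n. (- ((-1) ^ n * zeta_coeff n) - (if n = 0 then 1 else 0)) * t ^ n)
                    sums zeta_kernel t" .
  qed auto
  thus ?thesis using assms by simp
qed

text \<open>Without its poles at \<open>\<plusminus>2\<pi>\<i>\<close> the kernel is holomorphic on the ball of radius \<open>4\<pi>\<close>, so up to
  \<open>O((3\<pi>)\<^sup>-\<^sup>n)\<close> the coefficients are those of \<open>1 / (t - 2\<pi>\<i>) + 1 / (t + 2\<pi>\<i>)\<close>.\<close>

lemma zeta_coeff_asymptotics:
  "(\<lambda>n. zeta_coeff n * (2 * pi * \<i>) ^ Suc n + (1 + (-1) ^ Suc n)) \<longlonglongrightarrow> 0"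
proof -
  define a :: complex where "a = 2 * pi * \<i>"
  have a: "a \<noteq> 0" "norm a = 2 * pi" and exp_a: "exp a = 1" "exp (-a) = 1"
    by (simp_all add: a_def norm_mult exp_minus)
  define h where "h = (\<lambda>t. zeta_kernel t - 1 / (t - a) - 1 / (t + a))"
  have zero: "t = 0 \<or> t = a \<or> t = -a" if "exp t = 1" "norm t < 4 * pi" for t
  proof -
    from that(1) obtain n :: int where n: "Re t = 0" "Im t = of_int (2 * n) * pi"
      by (auto simp: exp_eq_1)
    have "\<bar>real_of_int (2 * n)\<bar> * pi < 4 * pi"
      using that(2) n by (simp add: cmod_eq_Im abs_mult)
    hence "\<bar>real_of_int n\<bar> < 2" by (simp add: abs_mult)
    hence "n \<in> {-1, 0, 1}" by auto
    thus ?thesis using n by (auto simp: complex_eq_iff a_def)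
  qed
  have h_ana: "h analytic_on {t}" if "norm t < 4 * pi" "t \<notin> {a, -a}" for t
    unfolding h_def using that zero[of t] 
    by (auto intro!: analytic_intros zeta_kernel_analytic simp: eq_neg_iff_add_eq_0)
  have pole: "remove_sings h analytic_on {w}" if w: "w \<in> {a, -a}" for w
  proof -
    have w0: "w \<noteq> 0" "exp w = 1" "norm w = 2 * pi" using w a exp_a by auto
    have h_w: "h = (\<lambda>t. zeta_kernel t - 1 / (t - w) - 1 / (t + w))"
      using w by (auto simp: h_def)
    have "\<forall>\<^sub>F t in at w. t \<noteq> w \<and> t \<noteq> 0"
      using w0 by (intro eventually_conj eventually_neq_at_within)
    \<comment> \<open>By periodicity of exp, \<open>zeta_kernel (t - w)\<close> is 1/(e^t - 1) -
      1/(t - w) near w. It has absorbed the pole at w, and the remaining two fractions are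
      continuous there.\<close>
    hence ev: "\<forall>\<^sub>F t in at w. zeta_kernel (t - w) - 1 / t - 1 / (t + w) = h t"
      by eventually_elim (auto simp: h_w zeta_kernel_def exp_diff w0)
    have "isCont zeta_kernel (w - w)"
      using zeta_kernel_analytic_0 by (simp add: analytic_at_imp_isCont)
    hence "isCont (\<lambda>t. zeta_kernel (t - w)) w"
      by (intro isCont_o2[of w "\<lambda>t. t - w" zeta_kernel] continuous_diff continuous_ident continuous_const)
    hence "(\<lambda>t. zeta_kernel (t - w) - 1 / t - 1 / (t + w)) \<midarrow>w\<rightarrow>
             zeta_kernel (w - w) - 1 / w - 1 / (w + w)"
      using w0 by (intro tendsto_intros isContD) auto
    hence lim: "h \<midarrow>w\<rightarrow> zeta_kernel (w - w) - 1 / w - 1 / (w + w)"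
      by (rule Lim_transform_eventually) (rule ev)
    have "h analytic_on (\<Union>t\<in>ball w (2 * pi) - {w}. {t})"
      unfolding analytic_on_UN
    proof
      fix t assume t: "t \<in> ball w (2 * pi) - {w}"
      have "norm t < 4 * pi" 
        using norm_triangle_ineq[of w "t - w"] t w0 by (simp add: dist_norm norm_minus_commute)
      moreover have "t \<noteq> - w"
        using t w0 by (auto simp: dist_norm)
      ultimately show "h analytic_on {t}" using t w by (intro h_ana) auto
    qed
    hence "isolated_singularity_at h w"
      unfolding isolated_singularity_at_def by (intro exI[of _ "2 * pi"]) auto
    thus ?thesis using lim by (rule remove_sings_analytic_at)
  qed
  have "remove_sings h analytic_on (\<Union>t\<in>ball 0 (4 * pi). {t})"
    unfolding analytic_on_UN using pole h_ana remove_sings_analytic_on by (metis mem_ball_0)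
  hence hol: "remove_sings h holomorphic_on ball 0 (4 * pi)"
    by (intro analytic_imp_holomorphic) simp
  define c where "c = (\<lambda>n. (deriv ^^ n) (remove_sings h) 0 / fact n)"
  have c_sums: "(\<lambda>n. c n * t ^ n) sums remove_sings h t" if "norm t < 4 * pi" for t
    using holomorphic_power_series[OF hol, of t] that by (simp add: c_def)
  have geo: "(\<lambda>n. - (t ^ n / w ^ Suc n)) sums (1 / (t - w))" if "norm t < norm w" for t w :: complex
  proof -
    have w: "w \<noteq> 0" "t \<noteq> w" using that by auto
    have "(\<lambda>n. (-1 / w) * (t / w) ^ n) sums ((-1 / w) * (1 / (1 - t / w)))"
      using that w by (intro sums_mult geometric_sums) (simp add: norm_divide)
    also have "(-1 / w) * (1 / (1 - t / w)) = 1 / (t - w)"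
      using w by (simp add: divide_simps)
    finally show ?thesis by (simp add: power_divide)
  qed
  \<comment> \<open>Adds back the geometric expansions at 0 of the two subtracted fractions.\<close>
  have eq: "zeta_coeff n = c n - 1 / a ^ Suc n - 1 / (-a) ^ Suc n" for n
  proof (rule zeta_coeff_unique)
    fix t :: complex assume t: "norm t < 2 * pi"
    hence t4: "norm t < 4 * pi" using pi_gt_zero by linarith
    have "h analytic_on {t}" using a t by (intro h_ana t4) auto
    hence h_t: "remove_sings h t = zeta_kernel t - 1 / (t - a) - 1 / (t - (-a))"
      by (simp add: h_def)
    have "(\<lambda>n. c n * t ^ n + - (t ^ n / a ^ Suc n) + - (t ^ n / (-a) ^ Suc n)) sums
            (remove_sings h t + 1 / (t - a) + 1 / (t - (-a)))"
      by (intro sums_add c_sums geo t4) (use t a in auto)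
    thus "(\<lambda>n. (c n - 1 / a ^ Suc n - 1 / (-a) ^ Suc n) * t ^ n) sums zeta_kernel t"
      unfolding h_t by (simp add: algebra_simps)
  qed auto
  \<comment> \<open>Any radius strictly between 2\<pi> and 4\<pi> would do: inside the larger disc
    \<open>c n * R ^ n\<close> tends to 0, and \<open>a / R\<close> has norm 2/3.\<close>
  define R :: complex where "R = of_real (3 * pi)"
  have R: "norm R = 3 * pi" "R \<noteq> 0" by (simp_all add: R_def)
  have "(\<lambda>n. c n * R ^ n) \<longlonglongrightarrow> 0"
    using c_sums[of R] by (intro summable_LIMSEQ_zero) (auto simp: sums_iff R)
  moreover have "(\<lambda>n. a * (a / R) ^ n) \<longlonglongrightarrow> a * 0"
    by (intro tendsto_intros LIMSEQ_power_zero) (simp add: norm_divide R a)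
  ultimately have "(\<lambda>n. (c n * R ^ n) * (a * (a / R) ^ n)) \<longlonglongrightarrow> 0 * (a * 0)"
    by (rule tendsto_mult)
  also have "(\<lambda>n. (c n * R ^ n) * (a * (a / R) ^ n)) = 
               (\<lambda>n. zeta_coeff n * a ^ Suc n + (1 + (-1) ^ Suc n))"
  proof
    fix n
    have "(-a) ^ Suc n = (-1) ^ Suc n * a ^ Suc n" by (rule power_minus)
    moreover have "1 / (-1 :: complex) ^ Suc n = (-1) ^ Suc n" by (cases "even n") auto
    ultimately have "zeta_coeff n * a ^ Suc n = c n * a ^ Suc n - 1 - (-1) ^ Suc n"
      using a by (simp add: eq algebra_simps divide_simps del: power_Suc)
    thus "(c n * R ^ n) * (a * (a / R) ^ n) = zeta_coeff n * a ^ Suc n + (1 + (-1) ^ Suc n)"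
      using R by (simp add: power_divide)
  qed
  finally show ?thesis by (simp add: a_def)
qed

section \<open>Continuation of the Riemann zeta function\<close>

text \<open>The majorant is demanded only for large \<open>n\<close>, because in the series over the
  poles of Gamma the early terms near a given point escape the uniform estimate.\<close>

lemma holomorphic_on_suminf:
  fixes f :: "nat \<Rightarrow> complex \<Rightarrow> complex"
  assumes "open S" "\<And>n. f n holomorphic_on S"
    and "\<And>x. x \<in> S \<Longrightarrow> \<exists>d>0. cball x d \<subseteq> S \<and>
           (\<exists>M. summable M \<and> (\<forall>\<^sub>F n in sequentially. \<forall>y\<in>cball x d. norm (f n y) \<le> M n))"
  shows "(\<lambda>x. \<Sum>n. f n x) holomorphic_on S"
proof (rule holomorphic_uniform_sequence)
  fix x assume "x \<in> S"
  from assms(3)[OF this] obtain d M where d: "d > 0" "cball x d \<subseteq> S" "summable M"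
      "\<forall>\<^sub>F n in sequentially. \<forall>y\<in>cball x d. norm (f n y) \<le> M n" by blast
  have "uniform_limit (cball x d) (\<lambda>N x. \<Sum>n<N. f n x) (\<lambda>x. \<Sum>n. f n x) sequentially"
    by (rule Weierstrass_m_test_ev[OF d(4,3)])
  with d show "\<exists>d>0. cball x d \<subseteq> S \<and> uniform_limit (cball x d) (\<lambda>N x. \<Sum>n<N. f n x) (\<lambda>x. \<Sum>n. f n x) sequentially"
    by blast
qed (use assms in \<open>auto intro!: holomorphic_intros\<close>)

text \<open>The entire extension of \<open>1 / (\<Gamma>(s) (s + n))\<close>.\<close>

definition rGamma_pole :: "nat \<Rightarrow> complex \<Rightarrow> complex" where
  "rGamma_pole n s = rGamma (s + of_nat (Suc n)) * pochhammer s n"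

lemma rGamma_pole_eq: "rGamma_pole n s * (s + of_nat n) = rGamma s"
  using pochhammer_rGamma[of s "Suc n"] by (simp add: rGamma_pole_def pochhammer_Suc mult_ac)

lemma rGamma_pole_same: "rGamma_pole n (- of_nat n) = (-1) ^ n * fact n"
  by (simp add: rGamma_pole_def pochhammer_same)

lemma rGamma_pole_neq: "m \<noteq> n \<Longrightarrow> rGamma_pole m (- of_nat n) = 0"
proof -
  assume mn: "m \<noteq> n"
  have "rGamma_pole m (- of_nat n) * (of_nat m - of_nat n) = 0"
    using rGamma_pole_eq[of m "- of_nat n"] by (simp add: rGamma_eq_zero_iff)
  thus ?thesis using mn by simp
qed

lemma rGamma_pole_series_holomorphic:
  "(\<lambda>s. \<Sum>n. zeta_coeff n * rGamma_pole n s) holomorphic_on UNIV"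
proof (rule holomorphic_on_suminf)
  fix x :: complex
  have "compact (rGamma ` cball x 1)"
    by (intro compact_continuous_image continuous_on_rGamma) auto
  then obtain C where C: "\<And>y. y \<in> cball x 1 \<Longrightarrow> norm (rGamma y) \<le> C"
    using compact_imp_bounded[of "rGamma ` cball x 1"] unfolding bounded_iff by blast
  \<comment> \<open>For n \<ge> N this keeps y + n at distance at least 1 from 0 throughout the unit
    ball around x, so dividing \<open>rGamma y\<close> by y + n does not increase its norm.\<close>
  obtain N :: nat where N: "real N \<ge> norm x + 2" by (metis real_arch_simple)
  have "norm (zeta_coeff n * rGamma_pole n y) \<le> C * norm (zeta_coeff n)"
    if "n \<ge> N" "y \<in> cball x 1" for n y
  proof -
    have "norm y \<le> norm x + 1"
      using that(2) norm_triangle_ineq2[of y x] by (simp add: dist_norm norm_minus_commute)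
    moreover have "real n \<ge> norm x + 2" using that(1) N by linarith
    ultimately have "1 \<le> norm (y + of_nat n)"
      using norm_diff_ineq[of "of_nat n" y] by (simp add: add.commute)
    hence "norm (rGamma_pole n y) * 1 \<le> norm (rGamma_pole n y) * norm (y + of_nat n)"
      by (intro mult_left_mono) auto
    also have "\<dots> = norm (rGamma y)" by (simp add: norm_mult [symmetric] rGamma_pole_eq)
    also have "\<dots> \<le> C" by (rule C) fact
    finally show ?thesis
      by (simp add: norm_mult mult.commute[of C] mult_left_mono)
  qed
  hence "\<forall>\<^sub>F n in sequentially. \<forall>y\<in>cball x 1. norm (zeta_coeff n * rGamma_pole n y) \<le> C * norm (zeta_coeff n)"
    by (intro eventually_mono[OF eventually_ge_at_top[of N]]) auto
  thus "\<exists>d>0. cball x d \<subseteq> UNIV \<and> (\<exists>M. summable M \<and> (\<forall>\<^sub>F n in sequentially. \<forall>y\<in>cball x d.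
          norm (zeta_coeff n * rGamma_pole n y) \<le> M n))"
    by (intro exI[of _ 1] conjI exI[of _ "\<lambda>n. C * norm (zeta_coeff n)"] summable_mult summable_norm_zeta_coeff) auto
qed (auto simp: rGamma_pole_def intro!: holomorphic_intros)

section \<open>The part of the Mellin integral over t \<ge> 1\<close>

definition zeta_integrand :: "complex \<Rightarrow> real \<Rightarrow> complex" where
  "zeta_integrand s t = of_real t powr (s - 1) / (exp (of_real t) - 1)"

text \<open>Cutting [1,\<infinity>) into unit intervals leaves only integrals over compact intervals
  away from 0. Each may be differentiated in s under the integral sign, and a Weierstrass majorant
  handles their sum.\<close>

definition zeta_tail :: "nat \<Rightarrow> complex \<Rightarrow> complex" where
  "zeta_tail m s = integral (cbox (real m + 1) (real m + 2)) (zeta_integrand s)"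

lemma exp_of_real_neq_1: "t \<noteq> 0 \<Longrightarrow> exp (of_real t :: complex) \<noteq> 1"
  by (metis exp_eq_one_iff exp_of_real of_real_1 of_real_eq_iff)

lemma continuous_on_zeta_integrand: "continuous_on {0<..} (zeta_integrand s)"
  unfolding zeta_integrand_def
  by (intro continuous_intros) (auto simp: exp_of_real_neq_1)

lemma zeta_tail_holomorphic: "zeta_tail m holomorphic_on UNIV"
proof -
  have "(\<lambda>s. integral (cbox (real m + 1) (real m + 2)) (zeta_integrand s)) holomorphic_on UNIV"
  proof (rule leibniz_rule_holomorphic)
    fix s :: complex and t :: real assume "t \<in> cbox (real m + 1) (real m + 2)"
    hence t: "t > 0" by auto
    show "((\<lambda>s. zeta_integrand s t) has_field_derivative
            ln (of_real t) * of_real t powr (s - 1) / (exp (of_real t) - 1)) (at s within UNIV)"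
      unfolding zeta_integrand_def using t exp_of_real_neq_1[of t]
      by (auto intro!: derivative_eq_intros simp: powr_def)
  next
    fix s :: complex
    show "zeta_integrand s integrable_on cbox (real m + 1) (real m + 2)"
      by (intro integrable_continuous continuous_on_subset[OF continuous_on_zeta_integrand]) auto
  next
    show "continuous_on (UNIV \<times> cbox (real m + 1) (real m + 2))
            (\<lambda>(s, t). ln (of_real t) * of_real t powr (s - 1) / (exp (of_real t :: complex) - 1))"
      unfolding case_prod_beta
      by (intro continuous_intros) (auto simp: exp_of_real_neq_1 complex_nonpos_Reals_iff)
  qed auto
  thus ?thesis by (simp add: zeta_tail_def [abs_def])
qed

lemma norm_zeta_tail_le:
  assumes "Re s - 1 \<le> c" "c \<ge> 0"
  shows "norm (zeta_tail m s) \<le> 2 * ((real m + 2) powr c * exp (-(real m + 1)))"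
proof -
  have "norm (zeta_integrand s t) \<le> 2 * ((real m + 2) powr c * exp (-(real m + 1)))"
    if t: "t \<in> cbox (real m + 1) (real m + 2)" for t
  proof -
    have t1: "t \<ge> 1" "t \<le> real m + 2" "t \<ge> real m + 1" using t by auto
    have "exp t \<ge> exp 1" using t1 by simp
    \<comment> \<open>Then e^t - 1 \<ge> e^t / 2, which is the origin of the factor 2 in the
      bound.\<close>
    hence "exp t \<ge> 2" using exp_ge_add_one_self[of 1] by linarith
    have "norm (zeta_integrand s t) = t powr (Re s - 1) / (exp t - 1)"
    proof -
      have "exp (of_real t) - 1 = (of_real (exp t - 1) :: complex)" by (simp add: exp_of_real)
      hence "norm (exp (of_real t) - 1 :: complex) = exp t - 1" 
        using t1 by (simp only: norm_of_real) simp
      thus ?thesis using t1 by (simp add: zeta_integrand_def norm_divide norm_powr_real_powr)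
    qed
    also have "\<dots> \<le> t powr (Re s - 1) / (exp t / 2)"
      using \<open>exp t \<ge> 2\<close> t1 by (intro divide_left_mono mult_pos_pos) auto
    also have "\<dots> = 2 * (t powr (Re s - 1) * exp (-t))" by (simp add: exp_minus field_simps)
    also have "\<dots> \<le> 2 * ((real m + 2) powr c * exp (-(real m + 1)))"
    proof (intro mult_left_mono mult_mono)
      have "t powr (Re s - 1) \<le> t powr c" using t1 assms by (intro powr_mono) auto
      also have "\<dots> \<le> (real m + 2) powr c" using t1 assms by (intro powr_mono2) auto
      finally show "t powr (Re s - 1) \<le> (real m + 2) powr c" .
    qed (use t1 in auto)
    finally show ?thesis .
  qed
  hence "norm (zeta_tail m s) \<le> 2 * ((real m + 2) powr c * exp (-(real m + 1))) *
           measure lborel (cbox (real m + 1) (real m + 2))"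
    unfolding zeta_tail_def
    by (intro has_integral_bound[OF _ integrable_integral] integrable_continuous
          continuous_on_subset[OF continuous_on_zeta_integrand]) auto
  thus ?thesis by simp
qed

lemma zeta_tail_series_holomorphic: "(\<lambda>s. \<Sum>m. zeta_tail m s) holomorphic_on UNIV"
proof (rule holomorphic_on_suminf)
  fix x :: complex
  define c where "c = norm x + 1"
  have "norm (zeta_tail m y) \<le> 2 * ((real m + 2) powr c * exp (-(real m + 1)))"
    if "y \<in> cball x 1" for m y
  proof (rule norm_zeta_tail_le)
    have "norm y \<le> norm x + 1"
      using that norm_triangle_ineq2[of y x] by (simp add: dist_norm norm_minus_commute)
    thus "Re y - 1 \<le> c" using complex_Re_le_cmod[of y] by (simp add: c_def)
  qed (simp add: c_def)
  moreover have "summable (\<lambda>m. 2 * ((real m + 2) powr c * exp (-(real m + 1))))"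
  proof (rule summable_comparison_test_bigo)
    show "(\<lambda>m. 2 * ((real m + 2) powr c * exp (-(real m + 1)))) \<in> O(\<lambda>m. 1 / real m ^ 2)"
      by real_asymp
  qed (use inverse_power_summable[of 2] in \<open>simp add: field_simps\<close>)
  ultimately show "\<exists>d>0. cball x d \<subseteq> UNIV \<and> (\<exists>M. summable M \<and>
      (\<forall>\<^sub>F n in sequentially. \<forall>y\<in>cball x d. norm (zeta_tail n y) \<le> M n))"
    by (intro exI[of _ 1] conjI exI[of _ "\<lambda>m. 2 * ((real m + 2) powr c * exp (-(real m + 1)))"]) auto
qed (auto intro: zeta_tail_holomorphic)

text \<open>The Mellin integral of \<open>1 / (e\<^sup>t - 1)\<close>, split at \<open>t = 1\<close> and divided by \<open>\<Gamma>(s)\<close>.\<close>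

definition zeta_cont :: "complex \<Rightarrow> complex" where
  "zeta_cont s = rGamma s / (s - 1) + (\<Sum>n. zeta_coeff n * rGamma_pole n s) +
                 rGamma s * (\<Sum>m. zeta_tail m s)"

text \<open>The quotient by s - 1 is the only ingredient of \<open>zeta_cont\<close> that is not
  entire.\<close>

lemma zeta_cont_analytic:
  assumes "s \<noteq> 1"
  shows "zeta_cont analytic_on {s}"
proof -
  have "(\<lambda>s. \<Sum>n. zeta_coeff n * rGamma_pole n s) analytic_on {s}"
       "(\<lambda>s. \<Sum>m. zeta_tail m s) analytic_on {s}"
    using rGamma_pole_series_holomorphic zeta_tail_series_holomorphic
    by (auto simp: analytic_at)
  thus ?thesis
    unfolding zeta_cont_def [abs_def] using assms analytic_rGamma[of "{s}"]
    by (intro analytic_intros) auto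
qed

lemma zeta_cont_meromorphic: "zeta_cont meromorphic_on UNIV"
proof -
  have "(\<lambda>s. \<Sum>n. zeta_coeff n * rGamma_pole n s) meromorphic_on UNIV"
       "(\<lambda>s. \<Sum>m. zeta_tail m s) meromorphic_on UNIV" "rGamma meromorphic_on UNIV"
    using rGamma_pole_series_holomorphic zeta_tail_series_holomorphic
    by (auto intro!: analytic_on_imp_meromorphic_on simp: analytic_on_open holomorphic_rGamma)
  thus ?thesis
    unfolding zeta_cont_def [abs_def] by (intro meromorphic_intros)
qed

text \<open>The zero of \<open>rGamma\<close> at -n kills the polar term, the tail and every term of
  the series except the one whose pole cancels it. The remaining factor (-1)^n n! is the reciprocal
  of the residue of Gamma at -n.\<close>

lemma zeta_cont_neg_nat: "zeta_cont (- of_nat n) = (-1) ^ n * fact n * zeta_coeff n"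
proof -
  have "(\<Sum>m. zeta_coeff m * rGamma_pole m (- of_nat n)) = (\<Sum>m\<in>{n}. zeta_coeff m * rGamma_pole m (- of_nat n))"
    by (rule suminf_finite) (auto simp: rGamma_pole_neq)
  thus ?thesis by (simp add: zeta_cont_def rGamma_eq_zero_iff rGamma_pole_same)
qed

section \<open>The Mellin integral for Re s > 1\<close>

lemma has_bochner_integral_indicator_lborelI:
  fixes f :: "real \<Rightarrow> complex"
  assumes "A \<in> sets borel" "continuous_on A f" "f absolutely_integrable_on A" "(f has_integral I) A"
  shows "has_bochner_integral lborel (\<lambda>x. indicator A x *\<^sub>R f x) I"
proof -
  \<comment> \<open>Continuity supplies Borel measurability, which allows the return from the
    completed measure to \<open>lborel\<close>.\<close>
  have meas: "(\<lambda>x. indicator A x *\<^sub>R f x) \<in> lborel \<rightarrow>\<^sub>M borel"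
    using borel_measurable_continuous_on_indicator[OF assms(1,2)] by simp
  have "(LINT x:A|lebesgue. f x) = integral A f"
    by (rule set_lebesgue_integral_eq_integral(2)) (rule assms(3))
  hence "integral\<^sup>L lborel (\<lambda>x. indicator A x *\<^sub>R f x) = I"
    using meas assms(4) by (simp add: set_lebesgue_integral_def integral_completion integral_unique)
  moreover have "integrable lborel (\<lambda>x. indicator A x *\<^sub>R f x)"
    using assms(3) meas by (simp add: set_integrable_def integrable_completion)
  ultimately show ?thesis by (simp add: has_bochner_integral_iff)
qed

lemma has_bochner_integral_powr_unit_interval:
  assumes z: "Re z > 0"
  shows "has_bochner_integral lborel (\<lambda>t. indicator {0<..<1} t *\<^sub>R (of_real t powr (z - 1) :: complex)) (1 / z)"
proof (rule has_bochner_integral_indicator_lborelI)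
  \<comment> \<open>The integrand may be unbounded at 0, but for Re z > 0 the antiderivative t^z / z
    is continuous up to 0, which is enough for the fundamental theorem.\<close>
  have I: "((\<lambda>t. complex_of_real t powr (z - 1)) has_integral (of_real 1 powr z / z - of_real 0 powr z / z)) {0..1}"
    using z by (intro fundamental_theorem_of_calculus_interior)
         (auto intro!: continuous_intros derivative_eq_intros has_vector_derivative_real_field)
  have "(\<lambda>t. t powr (Re z - 1)) integrable_on {0..1}"
    using has_integral_powr_from_0[of "Re z - 1" 1] z by (auto simp: has_integral_iff)
  hence "(\<lambda>t. norm (complex_of_real t powr (z - 1))) integrable_on {0..1}"
    by (rule integrable_eq) (auto simp: norm_powr_real_powr)
  hence "(\<lambda>t. complex_of_real t powr (z - 1)) absolutely_integrable_on {0..1}"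
    using I by (auto simp: absolutely_integrable_on_def)
  thus "(\<lambda>t. complex_of_real t powr (z - 1)) absolutely_integrable_on {0<..<1}"
    by (rule set_integrable_subset) auto
  show "((\<lambda>t. complex_of_real t powr (z - 1)) has_integral (1 / z)) {0<..<1}"
    using I by (simp add: has_integral_Icc_iff_Ioo)
qed (auto intro!: continuous_intros)

lemma has_bochner_integral_Gamma_scaled:
  assumes z: "Re z > 0" and a: "a > 0"
  shows "has_bochner_integral lborel
           (\<lambda>t. indicator {0<..} t *\<^sub>R (of_real t powr (z - 1) / of_real (exp (a * t)) :: complex))
           (Gamma z * of_real a powr (-z))"
proof -
  have "has_bochner_integral lborel
           (\<lambda>t. indicator {0<..} t *\<^sub>R (of_real t powr (z - 1) / of_real (exp t) :: complex)) (Gamma z)"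
    using z by (intro has_bochner_integral_indicator_lborelI absolutely_integrable_Gamma_integral'
                  Gamma_integral_complex' continuous_intros) auto
  hence "has_bochner_integral lborel (\<lambda>t. indicator {0<..} (0 + a * t) *\<^sub>R
           (of_real (0 + a * t) powr (z - 1) / of_real (exp (0 + a * t)) :: complex)) (Gamma z /\<^sub>R \<bar>a\<bar>)"
    using a by (subst lborel_has_bochner_integral_real_affine_iff [symmetric]) auto
  \<comment> \<open>The factor a^(1-z) turns (a t)^(z-1) back into t^(z-1); together with the
    Jacobian 1/a it accounts for a^(-z).\<close>
  hence "has_bochner_integral lborel (\<lambda>t. of_real a powr (1 - z) * (indicator {0<..} (0 + a * t) *\<^sub>R
           (of_real (0 + a * t) powr (z - 1) / of_real (exp (0 + a * t)) :: complex)))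
           (of_real a powr (1 - z) * (Gamma z /\<^sub>R \<bar>a\<bar>))"
    by (rule has_bochner_integral_mult_right)
  also have "of_real a powr (1 - z) * (Gamma z /\<^sub>R \<bar>a\<bar>) = Gamma z * of_real a powr (-z)"
    using a powr_diff[of "of_real a" 1 z] 
    by (simp add: scaleR_conv_of_real powr_minus field_simps)
  also have "(\<lambda>t. of_real a powr (1 - z) * (indicator {0<..} (0 + a * t) *\<^sub>R
           (of_real (0 + a * t) powr (z - 1) / of_real (exp (0 + a * t)) :: complex))) =
        (\<lambda>t. indicator {0<..} t *\<^sub>R (of_real t powr (z - 1) / of_real (exp (a * t)) :: complex))"
  proof
    fix t :: real
    show "of_real a powr (1 - z) * (indicator {0<..} (0 + a * t) *\<^sub>R
           (of_real (0 + a * t) powr (z - 1) / of_real (exp (0 + a * t)) :: complex)) =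
          indicator {0<..} t *\<^sub>R (of_real t powr (z - 1) / of_real (exp (a * t)) :: complex)"
    proof (cases "t > 0")
      case True
      have "of_real (a * t) powr (z - 1) = of_real a powr (z - 1) * (of_real t powr (z - 1) :: complex)"
        using True a by (simp add: powr_times_real)
      moreover have "of_real a powr (1 - z) * of_real a powr (z - 1) = (1 :: complex)"
        using a by (simp flip: powr_add)
      ultimately show ?thesis using True a by (simp add: mult.assoc [symmetric])
    next
      case False
      hence "\<not> (a * t > 0)" using a by (simp add: zero_less_mult_iff)
      thus ?thesis using False by simp
    qed
  qed
  finally show ?thesis .
qed

lemma has_bochner_integral_suminf:
  fixes f :: "nat \<Rightarrow> 'a \<Rightarrow> complex"
  assumes "\<And>n. has_bochner_integral M (f n) (I n)" "\<And>x. (\<lambda>n. f n x) sums F x"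
    and "\<And>x. summable (\<lambda>n. norm (f n x))" "summable (\<lambda>n. \<integral>x. norm (f n x) \<partial>M)"
  shows "has_bochner_integral M F (\<Sum>n. I n)"
proof -
  have F: "F = (\<lambda>x. \<Sum>n. f n x)" using assms(2) by (auto simp: sums_iff fun_eq_iff)
  have int: "integrable M (f n)" "integral\<^sup>L M (f n) = I n" for n
    using assms(1) by (auto simp: has_bochner_integral_iff)
  show ?thesis
    using integrable_suminf[OF int(1) _ assms(4)] integral_suminf[OF int(1) _ assms(4)] assms(3)
    by (simp add: has_bochner_integral_iff F int)
qed

text \<open>For t > 0 the integrand is the geometric series of t^(s-1) e^(-(n+1)t), each term of
  which is a scaled Gamma integral.\<close>

lemma has_bochner_integral_zeta_integrand:
  assumes s: "Re s > 1"
  shows "has_bochner_integral lborel (\<lambda>t. indicator {0<..} t *\<^sub>R zeta_integrand s t)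
           (Gamma s * euler_zagier_series 1 s)"
proof -
  \<comment> \<open>The parameter \<open>s\<close> is abstracted because taking norms replaces it by
    its real part: the integrals of the norms are then further instances of the same
    formula.\<close>
  define f where "f = (\<lambda>s n t. indicator {0<..} t *\<^sub>R
      (of_real t powr (s - 1) / of_real (exp (real (Suc n) * t)) :: complex))"
  have f: "has_bochner_integral lborel (f z n) (Gamma z * of_real (real (Suc n)) powr (-z))"
    if "Re z > 0" for z n
    unfolding f_def by (rule has_bochner_integral_Gamma_scaled) (use that in auto)
  have norm_f: "complex_of_real (norm (f s n t)) = f (of_real (Re s)) n t" for n t
    by (cases "t > 0")
       (auto simp: f_def norm_divide norm_powr_real_powr powr_of_real [symmetric] simp del: of_nat_Suc)
  have int_norm: "(\<integral>t. norm (f s n t) \<partial>lborel) = Gamma (Re s) * real (Suc n) powr (- Re s)" for n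
  proof -
    have "complex_of_real (\<integral>t. norm (f s n t) \<partial>lborel) = (\<integral>t. f (of_real (Re s)) n t \<partial>lborel)"
      by (simp only: integral_complex_of_real [symmetric] norm_f)
    also have "\<dots> = Gamma (of_real (Re s)) * of_real (real (Suc n)) powr (- of_real (Re s))"
      using s by (intro has_bochner_integral_integral_eq f) simp
    also have "\<dots> = of_real (Gamma (Re s) * real (Suc n) powr (- Re s))"
      by (simp add: Gamma_complex_of_real powr_of_real [symmetric] del: of_nat_Suc)
    finally show ?thesis by (simp only: of_real_eq_iff)
  qed
  have f_geo: "f s n t = indicator {0<..} t *\<^sub>R (of_real t powr (s - 1) * of_real (exp (-t)) ^ Suc n)" for n t
  proof -
    have "exp (real (Suc n) * t) = exp t ^ Suc n" by (rule exp_of_nat_mult)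
    thus ?thesis by (simp add: f_def exp_minus power_inverse divide_inverse)
  qed
  have "has_bochner_integral lborel (\<lambda>t. indicator {0<..} t *\<^sub>R zeta_integrand s t)
           (\<Sum>n. Gamma s * of_real (real (Suc n)) powr (-s))"
  proof (rule has_bochner_integral_suminf)
    show "has_bochner_integral lborel (f s n) (Gamma s * of_real (real (Suc n)) powr (-s))" for n
      using s by (intro f) auto
    show "(\<lambda>n. f s n t) sums (indicator {0<..} t *\<^sub>R zeta_integrand s t)" for t
    proof (cases "t > 0")
      case True
      define x :: complex where "x = of_real (exp (-t))"
      have x: "norm x < 1" using True by (simp add: x_def)
      have "(\<lambda>n. (of_real t powr (s - 1) * x) * x ^ n) sums ((of_real t powr (s - 1) * x) * (1 / (1 - x)))"
        by (intro sums_mult geometric_sums x)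
      also have "(\<lambda>n. (of_real t powr (s - 1) * x) * x ^ n) = (\<lambda>n. f s n t)"
        using True by (simp add: f_geo x_def mult.assoc)
      also have "(of_real t powr (s - 1) * x) * (1 / (1 - x)) = zeta_integrand s t"
      proof -
        have "x * exp (of_real t) = 1" by (simp add: x_def exp_of_real exp_minus)
        moreover have "x \<noteq> 1" using x by auto
        ultimately show ?thesis using exp_of_real_neq_1[of t] True
          by (simp add: zeta_integrand_def divide_simps) (simp add: algebra_simps)
      qed
      finally show ?thesis using True by simp
    qed (simp add: f_def)
    show "summable (\<lambda>n. norm (f s n t))" for t
    proof (cases "t > 0")
      case True
      have "summable (\<lambda>n. (t powr (Re s - 1) * exp (-t)) * exp (-t) ^ n)"
        using True by (intro summable_mult summable_geometric) simp
      thus ?thesis using True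
        by (simp add: f_geo norm_mult norm_power norm_powr_real_powr mult.assoc)
    qed (simp add: f_def)
    have "summable (\<lambda>n. real (Suc n) powr (- Re s))"
      using s by (subst summable_Suc_iff) (simp add: summable_real_powr_iff)
    thus "summable (\<lambda>n. \<integral>t. norm (f s n t) \<partial>lborel)"
      unfolding int_norm by (rule summable_mult)
  qed
  also have "(\<Sum>n. Gamma s * of_real (real (Suc n)) powr (-s)) = Gamma s * euler_zagier_series 1 s"
    using sums_mult[OF euler_zagier_series_1_sums[OF s], of "Gamma s"] by (simp add: sums_iff)
  finally show ?thesis .
qed

text \<open>Write 1/(e^t - 1) as 1/t plus the kernel. The first part yields 1/(s - 1), and the power
  series of the kernel, integrated termwise, yields the fractions 1/(s + n).\<close>

lemma has_bochner_integral_zeta_integrand_unit_interval: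
  assumes s: "Re s > 1"
  shows "has_bochner_integral lborel (\<lambda>t. indicator {0<..<1} t *\<^sub>R zeta_integrand s t)
           (1 / (s - 1) + (\<Sum>n. zeta_coeff n * (1 / (s + of_nat n))))"
proof -
  define f where "f = (\<lambda>s n t. indicator {0<..<1} t *\<^sub>R (of_real t powr (s + of_nat n - 1) :: complex))"
  have f: "has_bochner_integral lborel (f z n) (1 / (z + of_nat n))" if "Re z > 0" for z n
    unfolding f_def by (rule has_bochner_integral_powr_unit_interval) (use that in auto)
  have norm_f: "complex_of_real (norm (f s n t)) = f (of_real (Re s)) n t" for n t
  proof (cases "0 < t \<and> t < 1")
    case True
    have "of_real (t powr (Re s + real n - 1)) = complex_of_real t powr (of_real (Re s + real n - 1))"
      using True by (intro powr_of_real [symmetric]) simp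
    thus ?thesis using True by (simp add: f_def norm_powr_real_powr)
  qed (auto simp: f_def)
  have int_norm: "(\<integral>t. norm (f s n t) \<partial>lborel) = 1 / (Re s + real n)" for n
  proof -
    have "complex_of_real (\<integral>t. norm (f s n t) \<partial>lborel) = (\<integral>t. f (of_real (Re s)) n t \<partial>lborel)"
      by (simp only: integral_complex_of_real [symmetric] norm_f)
    also have "\<dots> = 1 / (of_real (Re s) + of_nat n)"
      using s by (intro has_bochner_integral_integral_eq f) simp
    also have "\<dots> = of_real (1 / (Re s + real n))" by simp
    finally show ?thesis by (simp only: of_real_eq_iff)
  qed
  have pow: "of_real t powr (s + of_nat n - 1) = of_real t powr (s - 1) * (of_real t ^ n :: complex)"
    if "t > 0" for t n
  proof -
    have "of_real t powr ((s - 1) + of_nat n) = of_real t powr (s - 1) * (of_real t ^ n :: complex)"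
      using that by (subst powr_add) (simp add: powr_nat')
    thus ?thesis by (simp add: algebra_simps)
  qed
  have "has_bochner_integral lborel
          (\<lambda>t. indicator {0<..<1} t *\<^sub>R (of_real t powr (s - 1) * zeta_kernel (of_real t)))
          (\<Sum>n. zeta_coeff n * (1 / (s + of_nat n)))"
  proof (rule has_bochner_integral_suminf)
    show "has_bochner_integral lborel (\<lambda>t. zeta_coeff n * f s n t) (zeta_coeff n * (1 / (s + of_nat n)))" for n
      using s by (intro has_bochner_integral_mult_right f) auto
    show "(\<lambda>n. zeta_coeff n * f s n t) sums
            (indicator {0<..<1} t *\<^sub>R (of_real t powr (s - 1) * zeta_kernel (of_real t)))" for t
    proof (cases "0 < t \<and> t < 1")
      case True
      have "(\<lambda>n. of_real t powr (s - 1) * (zeta_coeff n * of_real t ^ n)) sums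
              (of_real t powr (s - 1) * zeta_kernel (of_real t))"
        using True pi_gt3 by (intro sums_mult zeta_kernel_sums) auto
      thus ?thesis using True by (simp add: f_def pow mult_ac)
    qed (auto simp: f_def)
    show "summable (\<lambda>n. norm (zeta_coeff n * f s n t))" for t
    proof (rule summable_comparison_test'[OF summable_norm_zeta_coeff])
      fix n :: nat
      have "norm (f s n t) \<le> 1"
      proof (cases "0 < t \<and> t < 1")
        case True
        thus ?thesis using s by (auto simp: f_def norm_powr_real_powr intro!: powr_le1)
      qed (auto simp: f_def)
      thus "norm (norm (zeta_coeff n * f s n t)) \<le> norm (zeta_coeff n)"
        by (simp add: norm_mult mult_left_le)
    qed
    show "summable (\<lambda>n. \<integral>t. norm (zeta_coeff n * f s n t) \<partial>lborel)"
    proof (rule summable_comparison_test'[OF summable_norm_zeta_coeff])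
      fix n :: nat
      have "(\<integral>t. norm (zeta_coeff n * f s n t) \<partial>lborel) = norm (zeta_coeff n) * (1 / (Re s + real n))"
        by (simp add: norm_mult int_norm)
      also have "\<dots> \<le> norm (zeta_coeff n)"
        using s by (intro mult_left_le) (auto simp: divide_simps)
      finally show "norm (\<integral>t. norm (zeta_coeff n * f s n t) \<partial>lborel) \<le> norm (zeta_coeff n)"
        by simp
    qed
  qed
  \<comment> \<open>This instance is t^(s-2), the contribution of 1/t; its integrability at 0 is
    where Re s > 1 enters.\<close>
  moreover have "has_bochner_integral lborel (f (s - 1) 0) (1 / (s - 1 + of_nat 0))"
    using s by (intro f) auto
  ultimately have "has_bochner_integral lborel
          (\<lambda>t. f (s - 1) 0 t + indicator {0<..<1} t *\<^sub>R (of_real t powr (s - 1) * zeta_kernel (of_real t)))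
          (1 / (s - 1 + of_nat 0) + (\<Sum>n. zeta_coeff n * (1 / (s + of_nat n))))"
    by (intro has_bochner_integral_add)
  also have "(\<lambda>t. f (s - 1) 0 t + indicator {0<..<1} t *\<^sub>R (of_real t powr (s - 1) * zeta_kernel (of_real t)))
               = (\<lambda>t. indicator {0<..<1} t *\<^sub>R zeta_integrand s t)"
  proof
    fix t :: real
    show "f (s - 1) 0 t + indicator {0<..<1} t *\<^sub>R (of_real t powr (s - 1) * zeta_kernel (of_real t)) =
            indicator {0<..<1} t *\<^sub>R zeta_integrand s t"
    proof (cases "0 < t \<and> t < 1")
      case True
      have "of_real t powr (s - 1 - 1) = of_real t powr (s - 1) / (of_real t :: complex)"
        using True by (subst powr_diff) auto
      thus ?thesis using True
        by (simp add: f_def zeta_integrand_def zeta_kernel_def algebra_simps)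
    qed (auto simp: f_def)
  qed
  finally show ?thesis by simp
qed

text \<open>Half-open intervals are disjoint, as countable additivity requires, whereas
  \<open>zeta_tail\<close> uses compact ones; they differ by a null set.\<close>

lemma zeta_tail_eq:
  assumes "set_integrable lborel {0<..} (zeta_integrand s)"
  shows "(LINT t:{real m + 1..<real m + 2}|lborel. zeta_integrand s t) = zeta_tail m s"
proof -
  have "(LINT t:{real m + 1..<real m + 2}|lborel. zeta_integrand s t) =
          integral {real m + 1..<real m + 2} (zeta_integrand s)"
    by (intro set_borel_integral_eq_integral(2) set_integrable_subset[OF assms]) auto
  also have "\<dots> = integral {real m + 1..real m + 2} (zeta_integrand s)"
    by (rule integral_spike_set; rule negligible_subset[of "{real m + 2}"]) auto
  finally show ?thesis by (simp add: zeta_tail_def)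
qed

text \<open>The integral for Gamma(s) \<zeta>(s) is computed in two ways: as a whole by the
  geometric series, and cut at t = 1 into the kernel expansion and the unit pieces. Multiplication
  by \<open>rGamma s\<close> turns the second form into \<open>zeta_cont s\<close>.\<close>

lemma zeta_cont_eq_series:
  assumes s: "Re s > 1"
  shows "zeta_cont s = euler_zagier_series 1 s"
proof -
  note whole = has_bochner_integral_zeta_integrand[OF s]
  note unit = has_bochner_integral_zeta_integrand_unit_interval[OF s]
  have int: "set_integrable lborel {0<..} (zeta_integrand s)"
    using whole by (simp add: set_integrable_def has_bochner_integral_iff)
  have "\<exists>m. t \<in> {real m + 1..<real m + 2}" if "t \<ge> 1" for t
    using that by (intro exI[of _ "nat \<lfloor>t\<rfloor> - 1"]) (auto; linarith)
  hence Un: "{1..} = (\<Union>m. {real m + 1..<real m + 2})" by force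
  have "{0<..} = {0<..<1} \<union> {1 :: real..} \<and> {0<..<1} \<inter> {1 :: real..} = {}" by auto
  hence "(LINT t:{0<..}|lborel. zeta_integrand s t) =
          (LINT t:{0<..<1}|lborel. zeta_integrand s t) + (LINT t:{1..}|lborel. zeta_integrand s t)"
    by (metis (no_types, lifting) set_integral_Un[of "{0<..<1}" "{1..}" lborel "zeta_integrand s"]
          set_integrable_subset[OF int] Un_upper1 Un_upper2 sets.top sets_lborel borel_open borel_closed
          open_greaterThanLessThan closed_atLeast)
  also have "(LINT t:{1..}|lborel. zeta_integrand s t) =
               (\<Sum>m. LINT t:{real m + 1..<real m + 2}|lborel. zeta_integrand s t)"
    unfolding Un
  proof (rule lebesgue_integral_countable_add)
    show "set_integrable lborel (\<Union>m. {real m + 1..<real m + 2}) (zeta_integrand s)"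
      by (rule set_integrable_subset[OF int]) (auto simp flip: Un)
  next
    fix m j :: nat assume "m \<noteq> j"
    hence "real m + 1 \<le> real j \<or> real j + 1 \<le> real m"
      by (auto simp: nat_less_real_le [symmetric])
    thus "{real m + 1..<real m + 2} \<inter> {real j + 1..<real j + 2} = {}" by auto
  qed simp
  finally have Gamma_series: "Gamma s * euler_zagier_series 1 s =
      1 / (s - 1) + (\<Sum>n. zeta_coeff n * (1 / (s + of_nat n))) + (\<Sum>m. zeta_tail m s)"
    using whole unit by (simp add: has_bochner_integral_iff set_lebesgue_integral_def 
        zeta_tail_eq[OF int, unfolded set_lebesgue_integral_def])
  have "rGamma s * Gamma s = 1"
    using s Gamma_eq_zero_iff[of s] by (auto simp: rGamma_inverse_Gamma elim!: nonpos_Ints_cases)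
  have series: "(\<Sum>n. zeta_coeff n * rGamma_pole n s) = rGamma s * (\<Sum>n. zeta_coeff n * (1 / (s + of_nat n)))"
  proof -
    have "summable (\<lambda>n. zeta_coeff n * (1 / (s + of_nat n)))"
    proof (rule summable_comparison_test'[OF summable_norm_zeta_coeff])
      fix n :: nat
      have "1 \<le> norm (s + of_nat n)"
        using s complex_Re_le_cmod[of "s + of_nat n"] by simp
      hence "norm (1 / (s + of_nat n)) \<le> 1" by (simp add: norm_divide divide_le_eq_1)
      thus "norm (zeta_coeff n * (1 / (s + of_nat n))) \<le> norm (zeta_coeff n)"
        unfolding norm_mult by (rule mult_left_le) simp
    qed
    moreover have "zeta_coeff n * rGamma_pole n s = rGamma s * (zeta_coeff n * (1 / (s + of_nat n)))" for n
    proof -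
      have "Re (s + of_nat n) > 0" using s by simp
      hence "s + of_nat n \<noteq> 0" by (metis less_irrefl zero_complex.sel(1))
      thus ?thesis by (simp add: rGamma_pole_eq [symmetric, of s n])
    qed
    ultimately show ?thesis by (simp only: suminf_mult)
  qed
  have "zeta_cont s = rGamma s *
      (1 / (s - 1) + (\<Sum>n. zeta_coeff n * (1 / (s + of_nat n))) + (\<Sum>m. zeta_tail m s))"
    unfolding zeta_cont_def series by (simp only: distrib_left times_divide_eq_right mult_1_right)
  also have "\<dots> = (rGamma s * Gamma s) * euler_zagier_series 1 s"
    by (simp only: Gamma_series mult.assoc)
  finally show ?thesis using \<open>rGamma s * Gamma s = 1\<close> by simp
qed

section \<open>Stirling's formula\<close>

text \<open>Expressed by factorials, Wallis's product determines the constant in Stirling's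
  formula.\<close>

lemma wallis_product_eq:
  "(\<Prod>k=1..n. (4 * real k ^ 2) / (4 * real k ^ 2 - 1)) =
     (fact n ^ 2 * 4 ^ n / fact (2 * n)) ^ 2 / (2 * real n + 1)"
proof (induction n)
  case 0
  show ?case by simp
next
  case (Suc n)
  define A where "A = (\<lambda>n. fact n ^ 2 * 4 ^ n / (fact (2 * n) :: real))"
  have nz: "4 * real (Suc n) ^ 2 - 1 = (2 * real n + 1) * (2 * real n + 3)"
    by (simp add: power2_eq_square algebra_simps)
  have pos: "2 * real n + 1 \<noteq> 0" "2 * real n + 3 \<noteq> 0" "real n + 1 \<noteq> 0" by linarith+
  have fact_eqs: "fact (2 * Suc n) = 2 * (real n + 1) * (2 * real n + 1) * fact (2 * n)"
      "fact (Suc n) = (real n + 1) * fact n" "4 ^ Suc n = 4 * (4::real) ^ n"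
    by (simp_all add: algebra_simps)
  have *: "(x * F)^2 * (4 * P) / (2 * x * y * G) = F^2 * P / G * (2 * x / y)"
    if "x \<noteq> 0" "y \<noteq> 0" "G \<noteq> 0" for x y F P G :: real
    using that by (simp add: field_simps power2_eq_square)
  have A: "A (Suc n) = A n * (2 * (real n + 1) / (2 * real n + 1))"
    unfolding A_def fact_eqs by (rule *) (use pos in auto)
  have "(\<Prod>k=1..Suc n. (4 * real k ^ 2) / (4 * real k ^ 2 - 1)) =
          A n ^ 2 / (2 * real n + 1) * (4 * real (Suc n) ^ 2 / (4 * real (Suc n) ^ 2 - 1))"
    using Suc.IH by (simp add: A_def)
  also have "\<dots> = A (Suc n) ^ 2 / (2 * real (Suc n) + 1)"
    using pos unfolding A nz
    by (simp add: power_mult_distrib power_divide) (simp add: power2_eq_square algebra_simps)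
  finally show ?case by (simp only: A_def)
qed

text \<open>The sequence is the logarithm of n! / (n^(n+1/2) e^(-n)). The exponent shift 1/2 cancels
  the term of order 1/n in its increments, leaving O(1/n^2), which is summable. Starting at
  \<open>Suc n\<close> avoids the logarithm of 0.\<close>

lemma stirling_convergent:
  "convergent (\<lambda>n. ln (fact (Suc n)) - (real (Suc n) + 1/2) * ln (real (Suc n)) + real (Suc n))"
proof -
  define d where "d = (\<lambda>n. ln (fact (Suc n)) - (real (Suc n) + 1/2) * ln (real (Suc n)) + real (Suc n))"
  have diff: "d (Suc n) - d n = 1 - (real n + 3/2) * ln (1 + 1 / (real n + 1))" for n
  proof -
    have 1: "ln (fact (Suc (Suc n)) :: real) = ln (real n + 2) + ln (fact (Suc n))"
      by (subst fact_Suc, subst ln_mult) (auto simp: add_ac)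
    have 2: "ln (real n + 2) = ln (real n + 1) + ln (1 + 1 / (real n + 1))"
    proof -
      have "real n + 2 = (real n + 1) * (1 + 1 / (real n + 1))" by (simp add: field_simps)
      thus ?thesis by (simp only: ln_mult_pos add_pos_nonneg) (simp add: ln_mult_pos add_pos_nonneg)
    qed
    have 3: "real (Suc (Suc n)) = real n + 2" "real (Suc n) = real n + 1" by simp_all
    show ?thesis unfolding d_def 1 3 unfolding 2 by (simp add: field_simps del: fact_Suc)
  qed
  have "(\<lambda>n. d (Suc n) - d n) \<in> O(\<lambda>n. 1 / real n ^ 2)"
    unfolding diff by real_asymp
  hence "summable (\<lambda>n. d (Suc n) - d n)"
    by (rule summable_comparison_test_bigo [rotated]) (use inverse_power_summable[of 2] in \<open>simp add: field_simps\<close>)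
  hence "convergent (\<lambda>n. \<Sum>i<n. d (Suc i) - d i)"
    by (simp add: summable_iff_convergent)
  hence "convergent (\<lambda>n. d n - d 0)"
    by (simp add: sum_lessThan_telescope)
  hence "convergent (\<lambda>n. (d n - d 0) + d 0)"
    by (intro convergent_add convergent_const)
  hence "convergent d" by simp
  thus ?thesis unfolding d_def .
qed

lemma stirling:
  "(\<lambda>n. fact n / (sqrt (2 * pi * real n) * (real n / exp 1) ^ n)) \<longlonglongrightarrow> 1"
proof -
  define d where "d = (\<lambda>n. ln (fact n) - (real n + 1/2) * ln (real n) + real n)"
  obtain c where "(\<lambda>n. d (Suc n)) \<longlonglongrightarrow> c"
    using stirling_convergent by (auto simp: convergent_def d_def)
  hence d: "d \<longlonglongrightarrow> c" by (simp add: filterlim_sequentially_Suc)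
  have exp_d: "exp (d n) = fact n / (sqrt (real n) * (real n / exp 1) ^ n)" if "n > 0" for n
  proof -
    have "exp ((real n + 1/2) * ln (real n)) = sqrt (real n) * real n ^ n"
      using that by (simp add: ring_distribs exp_add powr_half_sqrt [symmetric] powr_def mult.commute
            flip: exp_of_nat_mult)
        (metis exp_ln exp_of_nat2_mult of_nat_0_less_iff mult.commute)
    thus ?thesis using that 
      by (simp add: d_def exp_add exp_diff power_divide exp_of_nat_mult [symmetric])
  qed
  \<comment> \<open>In 2 d(n) - d(2n) the powers of n/e cancel and the limit is still c, so
    comparison with Wallis's product identifies c.\<close>
  have "(\<lambda>n. exp (2 * (2 * d n - d (2 * n)))) \<longlonglongrightarrow> exp (2 * (2 * c - c))"
    by (intro tendsto_intros d filterlim_compose[OF d])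
       (auto intro!: filterlim_subseq simp: strict_mono_def)
  moreover have "(\<lambda>n. exp (2 * (2 * d n - d (2 * n)))) \<longlonglongrightarrow> 2 * pi"
  proof (rule Lim_transform_eventually)
    show "(\<lambda>n. (\<Prod>k=1..n. (4 * real k ^ 2) / (4 * real k ^ 2 - 1)) * (2 * (2 * real n + 1) / real n))
            \<longlonglongrightarrow> 2 * pi"
    proof -
      \<comment> \<open>The limit 4 turns Wallis's \<pi>/2 into 2\<pi>.\<close>
      have "(\<lambda>n. 2 * (2 * real n + 1) / real n) \<longlonglongrightarrow> 4" by real_asymp
      from tendsto_mult[OF wallis this] show ?thesis by simp
    qed
    show "\<forall>\<^sub>F n in sequentially. (\<Prod>k=1..n. (4 * real k ^ 2) / (4 * real k ^ 2 - 1)) *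
             (2 * (2 * real n + 1) / real n) = exp (2 * (2 * d n - d (2 * n)))"
      using eventually_gt_at_top[of 0]
    proof eventually_elim
      case (elim n)
      have "exp (2 * (2 * d n - d (2 * n))) = (exp (d n) ^ 2 / exp (d (2 * n))) ^ 2"
        by (simp only: exp_diff exp_double)
      also have "\<dots> = (fact n ^ 2 * 4 ^ n / fact (2 * n)) ^ 2 * (2 / real n)"
      proof -
        have q: "(sqrt 2 * x) ^ 2 = 2 * x ^ 2" for x
          by (simp add: power_mult_distrib)
        have *: "exp (d (2 * n)) = fact (2 * n) / (sqrt 2 * sqrt (real n) * (4 ^ n * ((real n / exp 1) ^ n) ^ 2))"
        proof -
          have "(real (2 * n) / exp 1) ^ (2 * n) = ((2 * (real n / exp 1)) ^ 2) ^ n"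
            by (simp add: power_mult)
          also have "\<dots> = 4 ^ n * ((real n / exp 1) ^ n) ^ 2"
            by (simp only: power_mult_distrib) (simp add: mult.commute flip: power_mult)
          finally show ?thesis using elim exp_d[of "2 * n"] by (simp add: real_sqrt_mult)
        qed
        have "(real n / exp 1) ^ n \<noteq> 0" "sqrt (real n) \<noteq> 0" using elim by auto
        hence "exp (d n) ^ 2 / exp (d (2 * n)) =
                 fact n ^ 2 * 4 ^ n / fact (2 * n) * (sqrt 2 / sqrt (real n))"
          unfolding * exp_d[OF elim] by (simp add: power2_eq_square field_simps)
        thus ?thesis by (simp only: power_mult_distrib power_divide) simp
      qed
      finally have "exp (2 * (2 * d n - d (2 * n))) =
          (fact n ^ 2 * 4 ^ n / fact (2 * n)) ^ 2 * (2 / real n)" .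
      moreover have "a / x * (2 * x / y) = a * (2 / y)" if "x > 0" for a x y :: real
        using that by simp
      from this[of "2 * real n + 1"] have "a / (2 * real n + 1) * (2 * (2 * real n + 1) / real n) = a * (2 / real n)" for a
        by simp
      ultimately show ?case
        unfolding wallis_product_eq by metis
    qed
  qed
  ultimately have "exp (2 * c) = 2 * pi"
    using LIMSEQ_unique by fastforce
  hence ec: "exp c = sqrt (2 * pi)"
    by (metis exp_double exp_ge_zero real_sqrt_unique)
  have "(\<lambda>n. exp (d n) / sqrt (2 * pi)) \<longlonglongrightarrow> exp c / sqrt (2 * pi)"
    by (intro tendsto_intros d) simp
  hence "(\<lambda>n. exp (d n) / sqrt (2 * pi)) \<longlonglongrightarrow> 1" by (simp add: ec)
  thus ?thesis
  proof (rule Lim_transform_eventually)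
    show "\<forall>\<^sub>F n in sequentially. exp (d n) / sqrt (2 * pi) =
            fact n / (sqrt (2 * pi * real n) * (real n / exp 1) ^ n)"
      using eventually_gt_at_top[of 0]
      by eventually_elim (simp add: exp_d real_sqrt_mult)
  qed
qed

section \<open>Values at negative integers\<close>

text \<open>Newton's identity solved for the last symmetric function, with the continued \<zeta>(j
  s) as power sums. It involves division by zero at the points s = 1/j, so it is not yet the
  normalised continuation.\<close>

fun newton_zeta :: "nat \<Rightarrow> complex \<Rightarrow> complex" where
  "newton_zeta 0 s = 1"
| "newton_zeta (Suc n) s =
     (\<Sum>i\<le>n. newton_zeta i s * ((-1) ^ (n - i) * zeta_cont (of_nat (Suc (n - i)) * s))) / of_nat (Suc n)"

lemma newton_zeta_1: "newton_zeta 1 s = zeta_cont s"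
  by simp

lemma newton_zeta_eq_series:
  assumes "Re s > 1"
  shows "newton_zeta r s = euler_zagier_series r s"
proof (induction r rule: less_induct)
  case (less r)
  show ?case
  proof (cases r)
    case (Suc n)
    have "newton_zeta (Suc n) s = (\<Sum>i\<le>n. euler_zagier_series i s *
        ((-1) ^ (n - i) * euler_zagier_series 1 (of_nat (Suc (n - i)) * s))) / of_nat (Suc n)"
      unfolding newton_zeta.simps zeta_cont_eq_series[OF Re_of_nat_Suc_mult_gt_1[OF assms]]
      by (intro arg_cong2[where f = "(/)"] sum.cong refl arg_cong2[where f = "(*)"] less.IH)
         (simp_all add: Suc)
    also have "\<dots> = euler_zagier_series (Suc n) s"
      unfolding euler_zagier_series_newton[OF assms, symmetric] by (simp del: of_nat_Suc)
    finally show ?thesis by (simp only: Suc)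
  qed (simp add: euler_zagier_series_0)
qed

lemma newton_zeta_meromorphic: "newton_zeta r meromorphic_on UNIV"
proof (induction r rule: less_induct)
  case (less r)
  show ?case
  proof (cases r)
    case 0
    have "newton_zeta 0 = (\<lambda>_. 1)" by auto
    thus ?thesis using 0 by (auto intro!: meromorphic_intros)
  next
    case (Suc n)
    have "(\<lambda>s. zeta_cont (of_nat j * s)) meromorphic_on UNIV" for j
      by (rule meromorphic_on_compose[OF zeta_cont_meromorphic]) (auto intro!: analytic_intros)
    hence "(\<lambda>s. (\<Sum>i\<le>n. newton_zeta i s * ((-1) ^ (n - i) * zeta_cont (of_nat (Suc (n - i)) * s))) /
             of_nat (Suc n)) meromorphic_on UNIV"
      using less.IH Suc by (intro meromorphic_intros) (auto simp del: of_nat_Suc)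
    also have "(\<lambda>s. (\<Sum>i\<le>n. newton_zeta i s * ((-1) ^ (n - i) * zeta_cont (of_nat (Suc (n - i)) * s))) /
             of_nat (Suc n)) = newton_zeta r"
      by (simp add: Suc fun_eq_iff del: of_nat_Suc)
    finally show ?thesis .
  qed
qed

text \<open>All singularities come from j s = 1, hence lie in the real interval (0,1]. On Re s > 1
  analyticity is needed for agreement with the series, on Re s \<le> 0 for the values at -k.\<close>

lemma newton_zeta_analytic:
  assumes "Re s \<le> 0 \<or> Re s > 1"
  shows "newton_zeta r analytic_on {s}"
proof (induction r rule: less_induct)
  case (less r)
  show ?case
  proof (cases r)
    case 0
    have "newton_zeta 0 = (\<lambda>_. 1)" by auto
    thus ?thesis using 0 by (auto intro!: analytic_intros)
  next
    case (Suc n)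
    have "(\<lambda>s. zeta_cont (of_nat (Suc j) * s)) analytic_on {s}" for j
    proof -
      have "of_nat (Suc j) * s \<noteq> 1"
      proof
        assume "of_nat (Suc j) * s = 1"
        hence "Re (of_nat (Suc j) * s) = 1" by (simp only: one_complex.simps)
        moreover have "Re (of_nat (Suc j) * s) \<le> 0" if "Re s \<le> 0"
          using that by (simp add: mult_nonneg_nonpos)
        moreover have "Re (of_nat (Suc j) * s) > 1" if "Re s > 1"
          using that by (rule Re_of_nat_Suc_mult_gt_1)
        moreover note assms
        ultimately show False by linarith
      qed
      hence "zeta_cont \<circ> (\<lambda>s. of_nat (Suc j) * s) analytic_on {s}"
        by (intro analytic_on_compose analytic_intros) (auto intro: zeta_cont_analytic)
      thus ?thesis by (simp add: o_def)
    qed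
    hence "(\<lambda>s. (\<Sum>i\<le>n. newton_zeta i s * ((-1) ^ (n - i) * zeta_cont (of_nat (Suc (n - i)) * s))) /
             of_nat (Suc n)) analytic_on {s}"
      using less.IH Suc by (intro analytic_intros) (auto simp del: of_nat_Suc)
    also have "(\<lambda>s. (\<Sum>i\<le>n. newton_zeta i s * ((-1) ^ (n - i) * zeta_cont (of_nat (Suc (n - i)) * s))) /
             of_nat (Suc n)) = newton_zeta r"
      by (simp add: Suc fun_eq_iff del: of_nat_Suc)
    finally show ?thesis .
  qed
qed

text \<open>\<open>remove_sings\<close> enforces the convention at the poles and leaves
  \<open>newton_zeta\<close> unchanged wherever it is analytic.\<close>

lemma euler_zagier_zeta_eq: "euler_zagier_zeta r = remove_sings (newton_zeta r)"
proof (rule euler_zagier_zeta_eqI)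
  show "remove_sings (newton_zeta r) nicely_meromorphic_on UNIV"
    by (intro remove_sings_nicely_meromorphic newton_zeta_meromorphic)
qed (simp_all add: newton_zeta_analytic newton_zeta_eq_series)

lemma euler_zagier_zeta_neg_nat: "euler_zagier_zeta r (- of_nat k) = newton_zeta r (- of_nat k)"
  unfolding euler_zagier_zeta_eq by (rule remove_sings_at_analytic) (simp add: newton_zeta_analytic)

lemma riemann_zeta_neg_nat: "riemann_zeta (- of_nat n) = (-1) ^ n * fact n * zeta_coeff n"
  unfolding euler_zagier_zeta_neg_nat by (simp add: zeta_cont_neg_nat)

lemma riemann_zeta_neg_even: "even n \<Longrightarrow> n > 0 \<Longrightarrow> riemann_zeta (- of_nat n) = 0"
  by (simp only: riemann_zeta_neg_nat zeta_coeff_even mult_zero_right)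

lemma euler_zagier_zeta_neg_newton:
  "of_nat (Suc n) * euler_zagier_zeta (Suc n) (- of_nat k) =
     (\<Sum>i\<le>n. (-1) ^ (n - i) * (euler_zagier_zeta i (- of_nat k) * riemann_zeta (- of_nat (Suc (n - i) * k))))"
proof -
  have z: "zeta_cont (of_nat (Suc j) * (- of_nat k)) = riemann_zeta (- of_nat (Suc j * k))" for j
    unfolding euler_zagier_zeta_neg_nat[of 1] newton_zeta_1 by (simp only: of_nat_mult mult_minus_right)
  have e: "newton_zeta i (- of_nat k) = euler_zagier_zeta i (- of_nat k)" for i
    by (rule euler_zagier_zeta_neg_nat [symmetric])
  have nz: "(of_nat (Suc n) :: complex) \<noteq> 0" by (simp only: of_nat_eq_0_iff)
  have "euler_zagier_zeta (Suc n) (- of_nat k) =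
      (\<Sum>i\<le>n. euler_zagier_zeta i (- of_nat k) *
        ((-1) ^ (n - i) * riemann_zeta (- of_nat (Suc (n - i) * k)))) / of_nat (Suc n)"
    unfolding euler_zagier_zeta_neg_nat[of "Suc n"] unfolding newton_zeta.simps unfolding z e ..
  hence "of_nat (Suc n) * euler_zagier_zeta (Suc n) (- of_nat k) =
      (\<Sum>i\<le>n. euler_zagier_zeta i (- of_nat k) *
        ((-1) ^ (n - i) * riemann_zeta (- of_nat (Suc (n - i) * k))))"
    by (simp only: times_divide_eq_right nonzero_mult_div_cancel_left[OF nz])
  thus ?thesis by (simp only: mult.left_commute)
qed

lemma euler_zagier_zeta_0_neg: "euler_zagier_zeta 0 (- of_nat k) = 1"
  by (simp add: euler_zagier_zeta_neg_nat)

text \<open>Newton's identity is 2 e_2 = p_1^2 - p_2, and p_2 = \<zeta>(-2k) is a trivial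
  zero.\<close>

lemma euler_zagier_zeta_2_neg_odd:
  assumes "odd k"
  shows "euler_zagier_zeta 2 (- of_nat k) = 1 / 2 * (riemann_zeta (- of_nat k))\<^sup>2"
proof -
  have "riemann_zeta (- of_nat (2 * k)) = 0"
    using assms by (intro riemann_zeta_neg_even) (auto elim: oddE)
  thus ?thesis
    using euler_zagier_zeta_neg_newton[of 1 k]
    by (simp add: euler_zagier_zeta_0_neg numeral_2_eq_2 power2_eq_square mult.commute)
qed

section \<open>Asymptotics of \<zeta> along the odd negative integers\<close>

lemma eventually_odd_at_topI:
  assumes "\<And>k. odd k \<Longrightarrow> k > 0 \<Longrightarrow> P k"
  shows "eventually P odd_at_top"
  unfolding eventually_inf_principal
  using eventually_gt_at_top[of 0] by eventually_elim (use assms in auto)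

lemma odd_at_top_le: "odd_at_top \<le> at_top"
  by simp

lemma filterlim_mult_odd_at_top:
  assumes "odd j"
  shows "filterlim (\<lambda>k. j * k) odd_at_top odd_at_top"
proof -
  have "filterlim (\<lambda>k. j * k) at_top at_top"
    using assms by (intro filterlim_subseq) (auto simp: strict_mono_def elim: oddE)
  hence "filterlim (\<lambda>k. j * k) at_top odd_at_top"
    by (rule filterlim_mono) auto
  moreover have "\<forall>\<^sub>F k in odd_at_top. j * k \<in> {k. odd k}"
    by (rule eventually_odd_at_topI) (use assms in auto)
  ultimately show ?thesis by (simp add: filterlim_inf filterlim_principal)
qed

lemma riemann_zeta_neg_odd_asymp:
  "(\<lambda>n. riemann_zeta (- of_nat n)) \<sim>[odd_at_top]
     (\<lambda>n. complex_of_real ((-1) ^ ((n + 1) div 2) * (2 * sqrt (real n) / sqrt (2 * pi)) *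
            (real n / (2 * pi * exp 1)) ^ n))"
proof -
  \<comment> \<open>For odd n the Taylor coefficient is asymptotically -2 / (2\<pi>i)^(n+1). Since
    i^(n+1) = (-1)^((n+1)/2) is its own inverse, \<zeta>(-n) is asymptotically
    \<open>c n * fact n\<close>.\<close>
  define c where "c = (\<lambda>n. complex_of_real ((-1) ^ ((n + 1) div 2) * 2 / (2 * pi) ^ Suc n))"
  have c: "- zeta_coeff n * (2 * pi * \<i>) ^ Suc n / 2 = (- fact n * zeta_coeff n) / (c n * fact n)" if "odd n" for n
  proof -
    have "\<i> ^ Suc n = (-1) ^ (Suc n div 2)"
    proof -
      have "\<i> ^ (2 * (Suc n div 2)) = (-1) ^ (Suc n div 2)" by (simp add: power_mult)
      moreover have "2 * (Suc n div 2) = Suc n" using that by simp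
      ultimately show ?thesis by simp
    qed
    moreover have "1 / (-1 :: complex) ^ m = (-1) ^ m" for m by (cases "even m") auto
    ultimately show ?thesis
      by (simp add: c_def power_mult_distrib field_simps del: power_Suc)
  qed
  have "filterlim (\<lambda>n. zeta_coeff n * (2 * pi * \<i>) ^ Suc n + (1 + (-1) ^ Suc n)) (nhds 0) odd_at_top"
    using zeta_coeff_asymptotics by (rule filterlim_mono) auto
  hence "filterlim (\<lambda>n. (2 - (zeta_coeff n * (2 * pi * \<i>) ^ Suc n + (1 + (-1) ^ Suc n))) / 2) (nhds ((2 - 0) / 2)) odd_at_top"
    by (intro tendsto_intros) auto
  moreover have "(2 - 0) / 2 = (1 :: complex)" by simp
  ultimately have "filterlim (\<lambda>n. (2 - (zeta_coeff n * (2 * pi * \<i>) ^ Suc n + (1 + (-1) ^ Suc n))) / 2) (nhds 1) odd_at_top"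
    by metis
  hence "filterlim (\<lambda>n. riemann_zeta (- of_nat n) / (c n * fact n)) (nhds 1) odd_at_top"
  proof (rule Lim_transform_eventually)
    show "\<forall>\<^sub>F n in odd_at_top. (2 - (zeta_coeff n * (2 * pi * \<i>) ^ Suc n + (1 + (-1) ^ Suc n))) / 2 =
            riemann_zeta (- of_nat n) / (c n * fact n)"
    proof (rule eventually_odd_at_topI)
      fix n :: nat assume "odd n"
      thus "(2 - (zeta_coeff n * (2 * pi * \<i>) ^ Suc n + (1 + (-1) ^ Suc n))) / 2 =
            riemann_zeta (- of_nat n) / (c n * fact n)"
        unfolding riemann_zeta_neg_nat using c[of n] by simp
    qed
  qed
  hence "(\<lambda>n. riemann_zeta (- of_nat n)) \<sim>[odd_at_top] (\<lambda>n. c n * fact n)"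
    by (rule asymp_equivI')
  also have "(\<lambda>n. c n * fact n) \<sim>[odd_at_top]
      (\<lambda>n. c n * complex_of_real (sqrt (2 * pi * real n) * (real n / exp 1) ^ n))"
  proof (intro asymp_equiv_mult asymp_equiv_refl)
    have "filterlim (\<lambda>n. fact n / (sqrt (2 * pi * real n) * (real n / exp 1) ^ n)) (nhds 1) odd_at_top"
      using stirling by (rule filterlim_mono) auto
    hence "filterlim (\<lambda>n. complex_of_real (fact n / (sqrt (2 * pi * real n) * (real n / exp 1) ^ n))) (nhds (of_real 1)) odd_at_top"
      by (rule tendsto_of_real)
    thus "(\<lambda>n. fact n) \<sim>[odd_at_top] (\<lambda>n. complex_of_real (sqrt (2 * pi * real n) * (real n / exp 1) ^ n))"
      by (intro asymp_equivI') (simp only: of_real_divide of_real_fact of_real_1)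
  qed
  also have "(\<lambda>n. c n * complex_of_real (sqrt (2 * pi * real n) * (real n / exp 1) ^ n)) =
     (\<lambda>n. complex_of_real ((-1) ^ ((n + 1) div 2) * (2 * sqrt (real n) / sqrt (2 * pi)) *
            (real n / (2 * pi * exp 1)) ^ n))"
  proof
    fix n :: nat
    have "sqrt (2 * pi * real n) / (2 * pi) = sqrt (real n) / sqrt (2 * pi)"
      by (simp add: real_sqrt_mult field_simps)
    hence "2 / (2 * pi) ^ Suc n * (sqrt (2 * pi * real n) * (real n / exp 1) ^ n) =
          2 * (sqrt (real n) / sqrt (2 * pi)) * ((real n / exp 1) ^ n / (2 * pi) ^ n)"
      by (simp add: field_simps)
    also have "(real n / exp 1) ^ n / (2 * pi) ^ n = (real n / (2 * pi * exp 1)) ^ n"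
      by (simp add: power_divide power_mult_distrib)
    finally have eq: "2 / (2 * pi) ^ Suc n * (sqrt (2 * pi * real n) * (real n / exp 1) ^ n) =
        2 * (sqrt (real n) / sqrt (2 * pi)) * (real n / (2 * pi * exp 1)) ^ n" .
    have "(-1) ^ ((n + 1) div 2) * 2 / (2 * pi) ^ Suc n * (sqrt (2 * pi * real n) * (real n / exp 1) ^ n) =
        (-1) ^ ((n + 1) div 2) * (2 / (2 * pi) ^ Suc n * (sqrt (2 * pi * real n) * (real n / exp 1) ^ n))"
      by (simp del: power_Suc)
    also have "\<dots> = (-1) ^ ((n + 1) div 2) * (2 * sqrt (real n) / sqrt (2 * pi)) *
            (real n / (2 * pi * exp 1)) ^ n"
      unfolding eq by simp
    finally show "c n * complex_of_real (sqrt (2 * pi * real n) * (real n / exp 1) ^ n) =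
      complex_of_real ((-1) ^ ((n + 1) div 2) * (2 * sqrt (real n) / sqrt (2 * pi)) *
            (real n / (2 * pi * exp 1)) ^ n)"
      unfolding c_def of_real_mult [symmetric] of_real_eq_iff .
  qed
  finally show ?thesis .
qed

section \<open>Dominant terms of Newton's recursion\<close>

text \<open>Up to powers of \<open>k\<close>, \<open>\<zeta>\<^sub>r(-k)\<close> has size \<open>growth_base r ^ k * ((k / (2\<pi>e)) ^ k) ^ r\<close>.
  Truncated subtraction makes \<open>growth_base 0 = 1\<close>.\<close>

definition growth_base :: "nat \<Rightarrow> nat" where
  "growth_base r = (if even r then (r - 1) ^ (r - 1) else r ^ r)"

text \<open>With base, power of k and multiplicity as separate parameters, products stay in the
  family: bases multiply, the other two add.\<close>

definition growth :: "nat \<Rightarrow> nat \<Rightarrow> nat \<Rightarrow> nat \<Rightarrow> complex" where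
  "growth q a r k =
     complex_of_real (real k ^ a * real q ^ k * ((real k / (2 * pi * exp 1)) ^ k) ^ r)"

lemma power_self_mult_less:
  fixes a b :: nat
  assumes "a \<ge> 2" "b \<ge> 2"
  shows "a ^ a * b ^ b < (a + b - 1) ^ (a + b - 1)"
proof -
  obtain b' where b: "b = Suc b'" using assms by (cases b) auto
  have "1 + real a * (real b' / real a) \<le> (1 + real b' / real a) ^ a"
    using Bernoulli_inequality[of "real b' / real a" a] assms by (simp add: le_divide_eq)
  also have "1 + real a * (real b' / real a) = real b" using assms b by simp
  finally have "real a ^ a * real b \<le> real a ^ a * (1 + real b' / real a) ^ a"
    by (intro mult_left_mono) auto
  also have "\<dots> = (real a + real b') ^ a"
    unfolding power_mult_distrib [symmetric] using assms by (simp add: distrib_left)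
  finally have "real (a ^ a * b) \<le> real ((a + b') ^ a)" by simp
  hence 1: "a ^ a * b \<le> (a + b') ^ a" by (simp only: of_nat_le_iff)
  have 2: "b ^ b' < (a + b') ^ b'"
    using assms b by (intro power_strict_mono) auto
  have "a ^ a * b ^ b = (a ^ a * b) * b ^ b'" by (simp add: b algebra_simps)
  also have "\<dots> \<le> (a + b') ^ a * b ^ b'" using 1 by (rule mult_right_mono) simp
  also have "\<dots> < (a + b') ^ a * (a + b') ^ b'"
    using 2 assms by (intro mult_strict_left_mono) auto
  also have "\<dots> = (a + b - 1) ^ (a + b - 1)" by (simp add: b power_add)
  finally show ?thesis .
qed

text \<open>A crude bound suffices: the left side has only i + j - 1 factors, none larger than i +
  j.\<close>

lemma growth_base_less_odd:
  assumes "even i" "i > 0" "odd j"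
  shows "growth_base i * j ^ j < growth_base (i + j)"
proof -
  have "i - 1 + j < i + j" "1 < i + j" using assms by (auto elim!: evenE)
  have "growth_base i * j ^ j \<le> (i + j) ^ (i - 1) * (i + j) ^ j"
    using assms by (auto simp: growth_base_def intro!: mult_mono power_mono)
  also have "\<dots> = (i + j) ^ (i - 1 + j)" by (simp add: power_add)
  also have "\<dots> < (i + j) ^ (i + j)"
    by (rule power_strict_increasing) fact+
  finally show ?thesis using assms by (simp add: growth_base_def)
qed

lemma growth_base_less_even:
  assumes "odd i" "i > 1" "odd j" "j > 1"
  shows "growth_base i * j ^ j < growth_base (i + j)"
  using power_self_mult_less[of i j] assms by (simp add: growth_base_def)

text \<open>Equality occurs for i = 0 and, with i odd, for i = 1 or j = 1. These ties are exactly
  the candidates for dominant terms.\<close>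

lemma growth_base_le:
  assumes "odd j"
  shows "growth_base i * j ^ j \<le> growth_base (i + j)"
proof (cases "even i")
  case True
  show ?thesis
  proof (cases "i = 0")
    case False
    with True assms show ?thesis by (intro less_imp_le growth_base_less_odd) auto
  qed (use assms in \<open>auto simp: growth_base_def\<close>)
next
  case False
  show ?thesis
  proof (cases "i = 1 \<or> j = 1")
    case True
    thus ?thesis using False assms by (auto simp: growth_base_def)
  next
    case False
    thus ?thesis using assms \<open>odd i\<close>
      by (intro less_imp_le growth_base_less_even) (auto elim!: oddE)
  qed
qed

section \<open>Comparison of growth rates\<close>

lemma growth_mult: "growth q a r k * growth q' a' r' k = growth (q * q') (a + a') (r + r') k"
  by (simp add: growth_def power_add power_mult_distrib mult_ac)

lemma growth_bigo:
  assumes "q \<le> q'" "a \<le> a'"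
  shows "growth q a r \<in> O[odd_at_top](growth q' a' r)"
proof (rule bigoI[of _ 1])
  show "\<forall>\<^sub>F k in odd_at_top. norm (growth q a r k) \<le> 1 * norm (growth q' a' r k)"
  proof (rule eventually_odd_at_topI)
    fix k :: nat assume k: "k > 0"
    have "real k ^ a * real q ^ k * ((real k / (2 * pi * exp 1)) ^ k) ^ r \<le>
            real k ^ a' * real q' ^ k * ((real k / (2 * pi * exp 1)) ^ k) ^ r"
      using k assms by (intro mult_right_mono mult_mono power_increasing power_mono) auto
    thus "norm (growth q a r k) \<le> 1 * norm (growth q' a' r k)"
      by (simp add: growth_def norm_mult norm_power norm_divide)
  qed
qed

text \<open>A strictly larger base beats any power of k, so imprecise powers of k in the upper
  bounds do no harm.\<close>

lemma growth_smallo: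
  assumes "q < q'"
  shows "growth q a r \<in> o[odd_at_top](growth q' 0 r)"
proof -
  define x where "x = real q / real q'"
  have x: "norm x < 1" "x \<ge> 0" using assms by (auto simp: x_def)
  have lim: "(\<lambda>k. real k ^ a * x ^ k) \<longlonglongrightarrow> 0"
  proof (cases "q = 0")
    case True
    have "\<forall>\<^sub>F k in sequentially. real k ^ a * x ^ k = 0"
      using eventually_gt_at_top[of 0] by eventually_elim (simp add: x_def True)
    thus ?thesis by (rule tendsto_eventually)
  next
    case False
    hence "0 < x" "x < 1" using x assms by (auto simp: x_def)
    hence "ln x < 0" by simp
    have "(\<lambda>k. real k ^ a * exp (real k * ln x)) \<longlonglongrightarrow> 0"
      using \<open>ln x < 0\<close> by real_asymp
    thus ?thesis using \<open>0 < x\<close> by (simp add: exp_of_nat_mult)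
  qed
  have "(\<lambda>k. real k ^ a * real q ^ k) \<in> o(\<lambda>k. real q' ^ k)"
  proof (rule smalloI_tendsto)
    show "(\<lambda>k. real k ^ a * real q ^ k / real q' ^ k) \<longlonglongrightarrow> 0"
      using lim by (simp add: x_def power_divide)
  qed (use assms in auto)
  hence "(\<lambda>k. complex_of_real (real k ^ a * real q ^ k)) \<in> o[odd_at_top](\<lambda>k. complex_of_real (real q' ^ k))"
    by (intro landau_o.small.filter_mono[OF odd_at_top_le]) (simp only: landau_o.small.of_real_iff)
  from landau_o.small_big_mult[OF this landau_o.big_refl[of "\<lambda>k. complex_of_real (((real k / (2 * pi * exp 1)) ^ k) ^ r)"]]
  show ?thesis by (simp add: growth_def [abs_def])
qed

lemma riemann_zeta_neg_mult_asymp: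
  assumes "odd j"
  shows "(\<lambda>k. riemann_zeta (- of_nat (j * k))) \<sim>[odd_at_top]
     (\<lambda>k. complex_of_real ((-1) ^ ((j * k + 1) div 2) * (2 * sqrt (real (j * k)) / sqrt (2 * pi)) *
            (real (j * k) / (2 * pi * exp 1)) ^ (j * k)))"
  using asymp_equiv_compose'[OF riemann_zeta_neg_odd_asymp filterlim_mult_odd_at_top[OF assms]] .

text \<open>The true order is sqrt k times \<open>growth (j ^ j) 0 j\<close>. To keep exponents
  integral, the half power is rounded up to 1 in the upper bound and down to 0 in the lower
  one.\<close>

lemma
  assumes "odd j"
  shows riemann_zeta_bigo_growth:
      "(\<lambda>k. riemann_zeta (- of_nat (j * k))) \<in> O[odd_at_top](growth (j ^ j) 1 j)"
    and growth_bigo_riemann_zeta: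
      "growth (j ^ j) 0 j \<in> O[odd_at_top](\<lambda>k. riemann_zeta (- of_nat (j * k)))"
proof -
  define \<Phi> where "\<Phi> = (\<lambda>k. complex_of_real ((-1) ^ ((j * k + 1) div 2) *
     (2 * sqrt (real (j * k)) / sqrt (2 * pi)) * (real (j * k) / (2 * pi * exp 1)) ^ (j * k)))"
  define C where "C = 2 * sqrt (real j) / sqrt (2 * pi)"
  have j: "j > 0" using assms by (auto elim!: oddE)
  have C: "C > 0" using j by (simp add: C_def)
  have asymp: "(\<lambda>k. riemann_zeta (- of_nat (j * k))) \<in> \<Theta>[odd_at_top](\<Phi>)"
    unfolding \<Phi>_def using riemann_zeta_neg_mult_asymp[OF assms] by (rule asymp_equiv_imp_bigtheta)
  have norm_\<Phi>: "norm (\<Phi> k) = C * sqrt (real k) * norm (growth (j ^ j) 0 j k)" for k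
  proof -
    have "(real (j * k) / (2 * pi * exp 1)) ^ (j * k) =
            (real j * (real k / (2 * pi * exp 1))) ^ (j * k)" by simp
    also have "\<dots> = real (j ^ j) ^ k * ((real k / (2 * pi * exp 1)) ^ k) ^ j"
      by (simp only: power_mult_distrib of_nat_power flip: power_mult) (simp only: mult.commute)
    finally have eq: "(real (j * k) / (2 * pi * exp 1)) ^ (j * k) =
        real (j ^ j) ^ k * ((real k / (2 * pi * exp 1)) ^ k) ^ j" .
    show ?thesis
      unfolding \<Phi>_def growth_def eq norm_of_real
      by (simp add: abs_mult C_def real_sqrt_mult power_abs)
  qed
  have "\<Phi> \<in> O[odd_at_top](growth (j ^ j) 1 j)"
  proof (rule bigoI[of _ C], rule eventually_odd_at_topI)
    fix k :: nat assume k: "k > 0"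
    have "sqrt (real k) \<le> real k" using k by (intro real_le_lsqrt) (auto simp: power2_eq_square)
    hence "C * sqrt (real k) * norm (growth (j ^ j) 0 j k) \<le> C * real k * norm (growth (j ^ j) 0 j k)"
      using C by (intro mult_right_mono mult_left_mono) auto
    also have "\<dots> = C * norm (growth (j ^ j) 1 j k)" by (simp add: growth_def norm_mult)
    finally show "norm (\<Phi> k) \<le> C * norm (growth (j ^ j) 1 j k)" unfolding norm_\<Phi> .
  qed
  with asymp show "(\<lambda>k. riemann_zeta (- of_nat (j * k))) \<in> O[odd_at_top](growth (j ^ j) 1 j)"
    using bigthetaD1 landau_o.big_trans by blast
  have "growth (j ^ j) 0 j \<in> O[odd_at_top](\<Phi>)"
  proof (rule bigoI[of _ "1 / C"], rule eventually_odd_at_topI)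
    fix k :: nat assume k: "k > 0"
    have "1 * norm (growth (j ^ j) 0 j k) \<le> sqrt (real k) * norm (growth (j ^ j) 0 j k)"
      using k by (intro mult_right_mono) auto
    thus "norm (growth (j ^ j) 0 j k) \<le> 1 / C * norm (\<Phi> k)"
      using C by (simp add: norm_\<Phi>)
  qed
  moreover have "\<Phi> \<in> O[odd_at_top](\<lambda>k. riemann_zeta (- of_nat (j * k)))"
    using asymp by (intro bigthetaD1) (simp only: bigtheta_sym)
  ultimately show "growth (j ^ j) 0 j \<in> O[odd_at_top](\<lambda>k. riemann_zeta (- of_nat (j * k)))"
    by (rule landau_o.big_trans)
qed

abbreviation newton_term :: "nat \<Rightarrow> nat \<Rightarrow> nat \<Rightarrow> complex" where
  "newton_term i j k \<equiv> euler_zagier_zeta i (- of_nat k) * riemann_zeta (- of_nat (j * k))"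

text \<open>Half of the terms in Newton's recursion vanish because of the trivial zeros of \<open>\<zeta>\<close>.\<close>

lemma newton_term_even:
  assumes "even j" "j > 0"
  shows "\<forall>\<^sub>F k in odd_at_top. newton_term i j k = 0"
proof (rule eventually_odd_at_topI)
  fix k :: nat assume "k > 0"
  hence "riemann_zeta (- of_nat (j * k)) = 0"
    using assms by (intro riemann_zeta_neg_even) auto
  thus "newton_term i j k = 0" by simp
qed

lemma newton_term_bigo:
  assumes "(\<lambda>k. euler_zagier_zeta i (- of_nat k)) \<in> O[odd_at_top](growth (growth_base i) i i)" "odd j"
  shows "newton_term i j \<in> O[odd_at_top](growth (growth_base i * j ^ j) (i + 1) (i + j))"
  using landau_o.big.mult[OF assms(1) riemann_zeta_bigo_growth[OF assms(2)]]
  by (simp add: growth_mult)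

text \<open>The power r of k is generous: each zeta factor costs at most one power, and i + 1 \<le>
  r in every term of the recursion.\<close>

lemma euler_zagier_zeta_bigo:
  "(\<lambda>k. euler_zagier_zeta r (- of_nat k)) \<in> O[odd_at_top](growth (growth_base r) r r)"
proof (induction r rule: less_induct)
  case (less r)
  show ?case
  proof (cases r)
    case 0
    thus ?thesis by (simp add: euler_zagier_zeta_0_neg growth_def [abs_def] growth_base_def)
  next
    case (Suc n)
    have eq: "euler_zagier_zeta r (- of_nat k) =
        (1 / of_nat (Suc n)) * (\<Sum>i\<le>n. (-1) ^ (n - i) * newton_term i (Suc (n - i)) k)" for k
      using euler_zagier_zeta_neg_newton[of n k, symmetric] unfolding Suc
      by (simp add: field_simps del: of_nat_Suc)
    have "(\<lambda>k. (-1) ^ (n - i) * newton_term i (Suc (n - i)) k) \<in> O[odd_at_top](growth (growth_base r) r r)"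
      if "i \<le> n" for i
    proof -
      have "newton_term i (Suc (n - i)) \<in> O[odd_at_top](growth (growth_base r) r r)"
      proof (cases "even (Suc (n - i))")
        case True
        show ?thesis
          by (rule landau_o.big.in_cong[THEN iffD2, OF newton_term_even[OF True]]) simp_all
      next
        case False
        have sum: "i + Suc (n - i) = r" using that Suc by simp
        have "newton_term i (Suc (n - i)) \<in>
                O[odd_at_top](growth (growth_base i * Suc (n - i) ^ Suc (n - i)) (i + 1) r)"
          using newton_term_bigo[OF less.IH False, of i] that Suc sum by simp
        also have "growth (growth_base i * Suc (n - i) ^ Suc (n - i)) (i + 1) r \<in>
                     O[odd_at_top](growth (growth_base r) r r)"
          using growth_base_le[OF False, of i] that sum Suc by (intro growth_bigo) simp_all
        finally show ?thesis .
      qed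
      thus ?thesis by simp
    qed
    hence "(\<lambda>k. \<Sum>i\<le>n. (-1) ^ (n - i) * newton_term i (Suc (n - i)) k) \<in>
             O[odd_at_top](growth (growth_base r) r r)"
      by (intro big_sum_in_bigo) auto
    thus ?thesis unfolding eq by (simp del: of_nat_Suc)
  qed
qed

text \<open>The function \<open>g\<close> stands for the dominant term, of which only a lower bound
  is used. The strict gap between the bases absorbs the k^(i+1) from the upper bound of the
  term.\<close>

lemma newton_term_smallo:
  assumes "even j \<or> growth_base i * j ^ j < growth_base (i + j)" "j > 0"
    and "growth (growth_base (i + j)) 0 (i + j) \<in> O[odd_at_top](g)"
  shows "(\<lambda>k. c * newton_term i j k) \<in> o[odd_at_top](g)"
proof -
  have "newton_term i j \<in> o[odd_at_top](g)"
  proof (cases "even j")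
    case True
    show ?thesis
      by (rule landau_o.small.in_cong[THEN iffD2, OF newton_term_even[OF True assms(2)]]) simp
  next
    case False
    have "newton_term i j \<in> O[odd_at_top](growth (growth_base i * j ^ j) (i + 1) (i + j))"
      by (intro newton_term_bigo euler_zagier_zeta_bigo False)
    also have "growth (growth_base i * j ^ j) (i + 1) (i + j) \<in>
                 o[odd_at_top](growth (growth_base (i + j)) 0 (i + j))"
      using assms(1) False by (intro growth_smallo) auto
    also note assms(3)
    finally show ?thesis .
  qed
  thus ?thesis by simp
qed

text \<open>The term i = 0 is \<zeta>(-rk), with sign +1 because n = r - 1 is even. For i \<ge> 1
  either j = r - i is even and the term vanishes, or i is even and positive and the base is strictly
  smaller.\<close>

lemma euler_zagier_zeta_asymp_odd:
  assumes "odd r"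
  shows "(\<lambda>k. euler_zagier_zeta r (- of_nat k)) \<sim>[odd_at_top]
           (\<lambda>k. 1 / of_nat r * riemann_zeta (- of_nat (r * k)))"
proof -
  obtain n where r: "r = Suc n" using assms by (cases r) auto
  have "growth (growth_base r) 0 r \<in> O[odd_at_top](\<lambda>k. riemann_zeta (- of_nat (r * k)))"
    using growth_bigo_riemann_zeta[OF assms] assms by (simp add: growth_base_def)
  hence small: "(\<lambda>k. (-1) ^ (n - i) * newton_term i (Suc (n - i)) k) \<in>
            o[odd_at_top](\<lambda>k. riemann_zeta (- of_nat (r * k)))" if "i \<in> {1..n}" for i
    using that assms r growth_base_less_odd[of i "Suc (n - i)"] 
    by (intro newton_term_smallo) auto
  have "(\<lambda>k. \<Sum>i=1..n. (-1) ^ (n - i) * newton_term i (Suc (n - i)) k) \<in>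
          o[odd_at_top](\<lambda>k. riemann_zeta (- of_nat (r * k)))"
    by (intro big_sum_in_smallo small)
  also have "(\<lambda>k. \<Sum>i=1..n. (-1) ^ (n - i) * newton_term i (Suc (n - i)) k) =
      (\<lambda>k. of_nat r * euler_zagier_zeta r (- of_nat k) - riemann_zeta (- of_nat (r * k)))"
  proof
    fix k
    have "{..n} = insert 0 {1..n}" by auto
    thus "(\<Sum>i=1..n. (-1) ^ (n - i) * newton_term i (Suc (n - i)) k) =
            of_nat r * euler_zagier_zeta r (- of_nat k) - riemann_zeta (- of_nat (r * k))"
      using euler_zagier_zeta_neg_newton[of n k] assms
      by (simp add: r euler_zagier_zeta_0_neg del: of_nat_Suc)
  qed
  finally have "(\<lambda>k. of_nat r * euler_zagier_zeta r (- of_nat k)) \<sim>[odd_at_top]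
                  (\<lambda>k. riemann_zeta (- of_nat (r * k)))"
    by (rule smallo_imp_asymp_equiv)
  from asymp_equiv_mult[OF asymp_equiv_refl[of "\<lambda>_. 1 / of_nat r"] this] show ?thesis
    using assms by (auto simp: r simp del: of_nat_Suc)
qed

lemma euler_zagier_zeta_asymp_even:
  assumes "even r" "r \<ge> 4"
  shows "(\<lambda>k. euler_zagier_zeta r (- of_nat k)) \<sim>[odd_at_top]
           (\<lambda>k. 1 / of_nat (r - 1) * riemann_zeta (- of_nat k) * riemann_zeta (- of_nat ((r - 1) * k)))"
proof -
  define n where "n = r - 1"
  have n: "r = Suc n" "odd n" "n \<ge> 3" using assms by (auto simp: n_def)
  define g where "g = (\<lambda>k. riemann_zeta (- of_nat k) * riemann_zeta (- of_nat (n * k)))"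
  have "(\<lambda>k. growth 1 0 1 k * growth (n ^ n) 0 n k) \<in> O[odd_at_top](g)"
    unfolding g_def
    using landau_o.big.mult[OF growth_bigo_riemann_zeta[of 1] growth_bigo_riemann_zeta[OF n(2)]] by simp
  hence g: "growth (growth_base r) 0 r \<in> O[odd_at_top](g)"
    using assms n by (simp add: growth_mult growth_base_def)
  \<comment> \<open>Even i makes the multiplier n - i + 1 even and the factor a trivial zero; odd i
    strictly between 1 and n gives a strictly smaller base.\<close>
  have small: "(\<lambda>k. (-1) ^ (n - i) * newton_term i (Suc (n - i)) k) \<in> o[odd_at_top](g)"
    if "i \<in> {..n} - {1, n}" for i
  proof (rule newton_term_smallo)
    have i: "i < n" "i \<noteq> 1" using that by auto
    show "even (Suc (n - i)) \<or> growth_base i * Suc (n - i) ^ Suc (n - i) < growth_base (i + Suc (n - i))"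
    proof (cases "odd i")
      case True
      hence "odd (Suc (n - i))" "1 < i" using i n by (auto elim!: oddE)
      thus ?thesis using True i by (intro disjI2 growth_base_less_even) auto
    qed (use i n in auto)
    show "growth (growth_base (i + Suc (n - i))) 0 (i + Suc (n - i)) \<in> O[odd_at_top](g)"
      using g i n by simp
  qed auto
  have sum_small: "(\<lambda>k. \<Sum>i\<in>{..n}-{1,n}. (-1) ^ (n - i) * newton_term i (Suc (n - i)) k) \<in> o[odd_at_top](g)"
    by (intro big_sum_in_smallo small)
  have eq: "(\<Sum>i\<in>{..n}-{1,n}. (-1) ^ (n - i) * newton_term i (Suc (n - i)) k) =
      of_nat r * euler_zagier_zeta r (- of_nat k) - g k -
      euler_zagier_zeta n (- of_nat k) * riemann_zeta (- of_nat k)" for k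
  proof -
    define t where "t = (\<lambda>i. (-1) ^ (n - i) * newton_term i (Suc (n - i)) k)"
    have "of_nat r * euler_zagier_zeta r (- of_nat k) = (\<Sum>i\<le>n. t i)"
      unfolding n(1) t_def by (rule euler_zagier_zeta_neg_newton)
    also have "{..n} = insert 1 (insert n ({..n} - {1, n}))" using n by auto
    also have "(\<Sum>i\<in>\<dots>. t i) = t 1 + (t n + (\<Sum>i\<in>{..n}-{1,n}. t i))"
      using n by (subst sum.insert) auto
    also have "t n = euler_zagier_zeta n (- of_nat k) * riemann_zeta (- of_nat k)" by (simp add: t_def)
    also have "t 1 = g k"
    proof -
      have "Suc (n - 1) = n" "even (n - 1)" using n by auto
      thus ?thesis by (simp only: t_def g_def power_minus_even power_one mult_1)
    qed
    finally show ?thesis by (simp add: t_def)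
  qed
  have "(\<lambda>k. euler_zagier_zeta n (- of_nat k) * riemann_zeta (- of_nat k)) \<sim>[odd_at_top]
          (\<lambda>k. 1 / of_nat n * riemann_zeta (- of_nat (n * k)) * riemann_zeta (- of_nat k))"
    by (intro asymp_equiv_mult euler_zagier_zeta_asymp_odd asymp_equiv_refl n)
  also have "(\<lambda>k. 1 / of_nat n * riemann_zeta (- of_nat (n * k)) * riemann_zeta (- of_nat k)) =
               (\<lambda>k. 1 / of_nat n * g k)" by (simp add: g_def mult_ac)
  finally have "(\<lambda>k. euler_zagier_zeta n (- of_nat k) * riemann_zeta (- of_nat k) - 1 / of_nat n * g k)
                  \<in> o[odd_at_top](\<lambda>k. 1 / of_nat n * g k)"
    by (rule asymp_equiv_imp_diff_smallo)
  hence "(\<lambda>k. euler_zagier_zeta n (- of_nat k) * riemann_zeta (- of_nat k) - 1 / of_nat n * g k)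
           \<in> o[odd_at_top](g)"
    using n by (subst (asm) landau_o.small.cmult) auto
  from sum_in_smallo(1)[OF sum_small this]
  have "(\<lambda>k. of_nat r * euler_zagier_zeta r (- of_nat k) - of_nat r / of_nat n * g k) \<in> o[odd_at_top](g)"
  proof (rule landau_o.small.in_cong[THEN iffD1, rotated])
    have "(of_nat n :: complex) \<noteq> 0" using n by auto
    hence r_n: "of_nat r / of_nat n = (1 + 1 / of_nat n :: complex)"
      by (simp add: n(1) field_simps)
    show "\<forall>\<^sub>F k in odd_at_top. (\<Sum>i\<in>{..n}-{1,n}. (-1) ^ (n - i) * newton_term i (Suc (n - i)) k) +
            (euler_zagier_zeta n (- of_nat k) * riemann_zeta (- of_nat k) - 1 / of_nat n * g k) =
          of_nat r * euler_zagier_zeta r (- of_nat k) - of_nat r / of_nat n * g k"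
      unfolding eq r_n by (intro always_eventually allI) (simp add: algebra_simps)
  qed
  hence "(\<lambda>k. of_nat r * euler_zagier_zeta r (- of_nat k) - of_nat r / of_nat n * g k)
           \<in> o[odd_at_top](\<lambda>k. of_nat r / of_nat n * g k)"
    by (subst landau_o.small.cmult) (use assms n(3) in \<open>simp_all only: divide_eq_0_iff of_nat_eq_0_iff, auto\<close>)
  hence "(\<lambda>k. of_nat r * euler_zagier_zeta r (- of_nat k)) \<sim>[odd_at_top] (\<lambda>k. of_nat r / of_nat n * g k)"
    by (rule smallo_imp_asymp_equiv)
  from asymp_equiv_mult[OF asymp_equiv_refl[of "\<lambda>_. 1 / of_nat r"] this]
  have "(\<lambda>k. euler_zagier_zeta r (- of_nat k)) \<sim>[odd_at_top] (\<lambda>k. 1 / of_nat n * g k)"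
    using assms by auto
  thus ?thesis by (simp add: g_def n_def mult.assoc)
qed

text \<open>The factor 1/n comes from Newton's recursion and sqrt n from Stirling's formula;
  together they are the -1/2 in the exponent.\<close>

lemma sqrt_mult_power_eq_powr:
  fixes n m :: nat
  assumes "n > 0"
  shows "1 / real n * sqrt (real n) * real n ^ m = real n powr (real m - 1 / 2)"
proof -
  have "real n powr (real m - 1 / 2) = real n powr ((real m + 1 / 2) - 1)" by simp
  also have "\<dots> = real n powr real m * real n powr (1 / 2) / real n"
    using assms by (simp only: powr_diff powr_add) simp
  finally show ?thesis using assms by (simp add: powr_half_sqrt powr_realpow)
qed

theorem theorem8:
  fixes r :: nat
  assumes "r \<ge> 1"
  shows "(odd r \<longrightarrow>
           ((\<lambda>k::nat. euler_zagier_zeta r (- of_nat k))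
              \<sim>[odd_at_top] (\<lambda>k. 1 / of_nat r * riemann_zeta (- of_nat (r * k)))) \<and>
           ((\<lambda>k::nat. 1 / of_nat r * riemann_zeta (- of_nat (r * k)))
              \<sim>[odd_at_top]
                (\<lambda>k. complex_of_real
                  ((- 1) ^ ((r * k + 1) div 2) * (2 * sqrt (real k) / sqrt (2 * pi))
                   * real r powr (real (r * k) - 1 / 2)
                   * (real k / (2 * pi * exp 1)) ^ (r * k))))) \<and>
         (\<forall>k::nat. odd k \<longrightarrow>
             euler_zagier_zeta 2 (- of_nat k) = 1 / 2 * (riemann_zeta (- of_nat k))\<^sup>2) \<and>
         ((\<lambda>k::nat. 1 / 2 * (riemann_zeta (- of_nat k))\<^sup>2)
            \<sim>[odd_at_top]
              (\<lambda>k. complex_of_real (real k / pi * (real k / (2 * pi * exp 1)) ^ (2 * k)))) \<and>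
         (even r \<and> r \<ge> 4 \<longrightarrow>
           ((\<lambda>k::nat. euler_zagier_zeta r (- of_nat k))
              \<sim>[odd_at_top]
                (\<lambda>k. 1 / of_nat (r - 1) * riemann_zeta (- of_nat k)
                       * riemann_zeta (- of_nat ((r - 1) * k)))) \<and>
           ((\<lambda>k::nat. 1 / of_nat (r - 1) * riemann_zeta (- of_nat k)
                       * riemann_zeta (- of_nat ((r - 1) * k)))
              \<sim>[odd_at_top]
                (\<lambda>k. complex_of_real
                  ((- 1) ^ (r div 2 - 1) * (2 * real k / pi)
                   * real (r - 1) powr (real ((r - 1) * k) - 1 / 2)
                   * (real k / (2 * pi * exp 1)) ^ (r * k)))))"
proof (intro conjI impI allI)
  assume r: "odd r"
  show "(\<lambda>k::nat. euler_zagier_zeta r (- of_nat k)) \<sim>[odd_at_top]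
          (\<lambda>k. 1 / of_nat r * riemann_zeta (- of_nat (r * k)))"
    by (rule euler_zagier_zeta_asymp_odd) fact
  have "r > 0" using r by (auto elim!: oddE)
  have "(\<lambda>k. 1 / of_nat r * riemann_zeta (- of_nat (r * k))) \<sim>[odd_at_top]
      (\<lambda>k. 1 / of_nat r * complex_of_real ((-1) ^ ((r * k + 1) div 2) *
        (2 * sqrt (real (r * k)) / sqrt (2 * pi)) * (real (r * k) / (2 * pi * exp 1)) ^ (r * k)))"
    by (intro asymp_equiv_mult asymp_equiv_refl riemann_zeta_neg_mult_asymp r)
  also have "(\<lambda>k. 1 / of_nat r * complex_of_real ((-1) ^ ((r * k + 1) div 2) *
        (2 * sqrt (real (r * k)) / sqrt (2 * pi)) * (real (r * k) / (2 * pi * exp 1)) ^ (r * k))) =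
      (\<lambda>k. complex_of_real ((- 1) ^ ((r * k + 1) div 2) * (2 * sqrt (real k) / sqrt (2 * pi))
         * real r powr (real (r * k) - 1 / 2) * (real k / (2 * pi * exp 1)) ^ (r * k)))"
  proof
    fix k :: nat
    have sqrt_eq: "2 * sqrt (real (r * k)) / sqrt (2 * pi) = 2 * sqrt (real k) / sqrt (2 * pi) * sqrt (real r)"
      by (simp add: real_sqrt_mult)
    have r_pow: "(real (r * k) / (2 * pi * exp 1)) ^ (r * k) =
        real r ^ (r * k) * (real k / (2 * pi * exp 1)) ^ (r * k)"
      by (simp add: power_mult_distrib power_divide)
    have "1 / real r * ((-1) ^ ((r * k + 1) div 2) * (2 * sqrt (real (r * k)) / sqrt (2 * pi)) *
            (real (r * k) / (2 * pi * exp 1)) ^ (r * k)) =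
          (-1) ^ ((r * k + 1) div 2) * (2 * sqrt (real k) / sqrt (2 * pi)) *
            (1 / real r * sqrt (real r) * real r ^ (r * k)) * (real k / (2 * pi * exp 1)) ^ (r * k)"
      unfolding sqrt_eq r_pow by (simp only: mult_ac)
    also have "1 / real r * sqrt (real r) * real r ^ (r * k) = real r powr (real (r * k) - 1 / 2)"
      by (rule sqrt_mult_power_eq_powr) fact
    finally have eq: "1 / real r * ((-1) ^ ((r * k + 1) div 2) * (2 * sqrt (real (r * k)) / sqrt (2 * pi)) *
            (real (r * k) / (2 * pi * exp 1)) ^ (r * k)) =
        (-1) ^ ((r * k + 1) div 2) * (2 * sqrt (real k) / sqrt (2 * pi)) *
          real r powr (real (r * k) - 1 / 2) * (real k / (2 * pi * exp 1)) ^ (r * k)" .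
    show "1 / of_nat r * complex_of_real ((-1) ^ ((r * k + 1) div 2) *
        (2 * sqrt (real (r * k)) / sqrt (2 * pi)) * (real (r * k) / (2 * pi * exp 1)) ^ (r * k)) =
      complex_of_real ((- 1) ^ ((r * k + 1) div 2) * (2 * sqrt (real k) / sqrt (2 * pi))
         * real r powr (real (r * k) - 1 / 2) * (real k / (2 * pi * exp 1)) ^ (r * k))"
      unfolding eq [symmetric] by (simp only: of_real_mult of_real_divide of_real_1 of_real_of_nat_eq)
  qed
  finally show "(\<lambda>k::nat. 1 / of_nat r * riemann_zeta (- of_nat (r * k))) \<sim>[odd_at_top] \<dots>" .
next
  fix k :: nat assume "odd k"
  thus "euler_zagier_zeta 2 (- of_nat k) = 1 / 2 * (riemann_zeta (- of_nat k))\<^sup>2"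
    by (rule euler_zagier_zeta_2_neg_odd)
next
  have "(\<lambda>k. 1 / 2 * (riemann_zeta (- of_nat k))\<^sup>2) \<sim>[odd_at_top]
      (\<lambda>k. 1 / 2 * (complex_of_real ((-1) ^ ((k + 1) div 2) * (2 * sqrt (real k) / sqrt (2 * pi)) *
            (real k / (2 * pi * exp 1)) ^ k))\<^sup>2)"
    by (intro asymp_equiv_mult asymp_equiv_refl asymp_equiv_power riemann_zeta_neg_odd_asymp)
  also have "(\<lambda>k. 1 / 2 * (complex_of_real ((-1) ^ ((k + 1) div 2) * (2 * sqrt (real k) / sqrt (2 * pi)) *
            (real k / (2 * pi * exp 1)) ^ k))\<^sup>2) =
      (\<lambda>k. complex_of_real (real k / pi * (real k / (2 * pi * exp 1)) ^ (2 * k)))"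
  proof
    fix k :: nat
    have "1 / 2 * ((-1) ^ ((k + 1) div 2) * (2 * sqrt (real k) / sqrt (2 * pi)) *
            (real k / (2 * pi * exp 1)) ^ k)\<^sup>2 =
          1 / 2 * ((-1) ^ ((k + 1) div 2))\<^sup>2 * (2 * sqrt (real k) / sqrt (2 * pi))\<^sup>2 *
            ((real k / (2 * pi * exp 1)) ^ k)\<^sup>2"
      by (simp only: power_mult_distrib mult.assoc)
    also have "((-1 :: real) ^ ((k + 1) div 2))\<^sup>2 = 1"
      by (simp only: power2_eq_square power_mult_distrib [symmetric]) simp
    also have "(2 * sqrt (real k) / sqrt (2 * pi))\<^sup>2 = 2 * (real k / pi)"
      by (simp add: power_divide power_mult_distrib)
    also have "((real k / (2 * pi * exp 1)) ^ k)\<^sup>2 = (real k / (2 * pi * exp 1)) ^ (2 * k)"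
      by (simp only: power_mult [symmetric] mult.commute)
    finally have eq: "1 / 2 * ((-1) ^ ((k + 1) div 2) * (2 * sqrt (real k) / sqrt (2 * pi)) *
            (real k / (2 * pi * exp 1)) ^ k)\<^sup>2 = real k / pi * (real k / (2 * pi * exp 1)) ^ (2 * k)"
      by simp
    show "1 / 2 * (complex_of_real ((-1) ^ ((k + 1) div 2) * (2 * sqrt (real k) / sqrt (2 * pi)) *
            (real k / (2 * pi * exp 1)) ^ k))\<^sup>2 =
          complex_of_real (real k / pi * (real k / (2 * pi * exp 1)) ^ (2 * k))"
      unfolding eq [symmetric] by (simp only: of_real_mult of_real_divide of_real_1 of_real_numeral of_real_power)
  qed
  finally show "(\<lambda>k::nat. 1 / 2 * (riemann_zeta (- of_nat k))\<^sup>2) \<sim>[odd_at_top] \<dots>" .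
next
  assume r: "even r \<and> r \<ge> 4"
  thus "(\<lambda>k::nat. euler_zagier_zeta r (- of_nat k)) \<sim>[odd_at_top]
          (\<lambda>k. 1 / of_nat (r - 1) * riemann_zeta (- of_nat k) * riemann_zeta (- of_nat ((r - 1) * k)))"
    by (intro euler_zagier_zeta_asymp_even) auto
  have odd: "odd (r - 1)" and pos: "r - 1 > 0" using r by auto
  have "(\<lambda>k. 1 / of_nat (r - 1) * riemann_zeta (- of_nat k) * riemann_zeta (- of_nat ((r - 1) * k)))
      \<sim>[odd_at_top]
      (\<lambda>k. 1 / of_nat (r - 1) * complex_of_real ((-1) ^ ((k + 1) div 2) *
          (2 * sqrt (real k) / sqrt (2 * pi)) * (real k / (2 * pi * exp 1)) ^ k) *
        complex_of_real ((-1) ^ (((r - 1) * k + 1) div 2) *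
          (2 * sqrt (real ((r - 1) * k)) / sqrt (2 * pi)) *
          (real ((r - 1) * k) / (2 * pi * exp 1)) ^ ((r - 1) * k)))"
    by (intro asymp_equiv_mult asymp_equiv_refl riemann_zeta_neg_mult_asymp riemann_zeta_neg_odd_asymp odd)
  also have "\<dots> \<sim>[odd_at_top] (\<lambda>k. complex_of_real ((- 1) ^ (r div 2 - 1) * (2 * real k / pi)
                   * real (r - 1) powr (real ((r - 1) * k) - 1 / 2)
                   * (real k / (2 * pi * exp 1)) ^ (r * k)))"
  \<comment> \<open>The two signs combine to a constant only for odd k, so the functions agree
    eventually along the filter and not at every k.\<close>
  proof (rule asymp_equiv_refl_ev, rule eventually_odd_at_topI)
    fix k :: nat assume k: "odd k"
    define n where "n = r - 1"
    define X where "X = real k / (2 * pi * exp 1)"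
    have r_n: "r = Suc n" and n: "n > 0" using pos by (auto simp: n_def)
    \<comment> \<open>For k = 2m + 1 and n = 2p + 1 the exponents add up to p modulo 2, and p = r/2
      - 1.\<close>
    have sign: "(-1 :: real) ^ ((k + 1) div 2) * (-1) ^ ((n * k + 1) div 2) = (-1) ^ (r div 2 - 1)"
    proof -
      obtain m where m: "k = 2 * m + 1" using k by (rule oddE)
      obtain p where p: "n = 2 * p + 1" using odd unfolding n_def by (rule oddE)
      have "(k + 1) div 2 + (n * k + 1) div 2 = p + 2 * (m + 1 + p * m)"
        by (simp add: m p algebra_simps)
      moreover have "r div 2 - 1 = p" by (simp add: r_n p)
      ultimately show ?thesis by (simp flip: power_add) (simp add: power_add power_mult)
    qed
    have X_pow: "X ^ k * X ^ (n * k) = X ^ (r * k)" by (simp add: r_n power_add)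
    have n_pow: "(real (n * k) / (2 * pi * exp 1)) ^ (n * k) = real n ^ (n * k) * X ^ (n * k)"
      by (simp add: X_def power_mult_distrib power_divide)
    have sqrt_eq: "(2 * sqrt (real k) / sqrt (2 * pi)) * (2 * sqrt (real (n * k)) / sqrt (2 * pi)) =
            2 * real k / pi * sqrt (real n)"
      by (simp add: real_sqrt_mult field_simps)
    have "1 / real n * ((-1) ^ ((k + 1) div 2) * (2 * sqrt (real k) / sqrt (2 * pi)) * X ^ k) *
            ((-1) ^ ((n * k + 1) div 2) * (2 * sqrt (real (n * k)) / sqrt (2 * pi)) *
              (real (n * k) / (2 * pi * exp 1)) ^ (n * k)) =
          ((-1) ^ ((k + 1) div 2) * (-1) ^ ((n * k + 1) div 2)) *
          ((2 * sqrt (real k) / sqrt (2 * pi)) * (2 * sqrt (real (n * k)) / sqrt (2 * pi))) *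
          (1 / real n * real n ^ (n * k)) * (X ^ k * X ^ (n * k))"
      unfolding n_pow by (simp only: mult_ac)
    also have "\<dots> = (-1) ^ (r div 2 - 1) * (2 * real k / pi) *
          (1 / real n * sqrt (real n) * real n ^ (n * k)) * X ^ (r * k)"
      unfolding sign sqrt_eq X_pow by (simp only: mult_ac)
    also have "1 / real n * sqrt (real n) * real n ^ (n * k) = real n powr (real (n * k) - 1 / 2)"
      by (rule sqrt_mult_power_eq_powr) fact
    finally have eq: "1 / real n * ((-1) ^ ((k + 1) div 2) * (2 * sqrt (real k) / sqrt (2 * pi)) * X ^ k) *
            ((-1) ^ ((n * k + 1) div 2) * (2 * sqrt (real (n * k)) / sqrt (2 * pi)) *
              (real (n * k) / (2 * pi * exp 1)) ^ (n * k)) =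
        (-1) ^ (r div 2 - 1) * (2 * real k / pi) * real n powr (real (n * k) - 1 / 2) * X ^ (r * k)" .
    show "1 / of_nat (r - 1) * complex_of_real ((-1) ^ ((k + 1) div 2) *
          (2 * sqrt (real k) / sqrt (2 * pi)) * (real k / (2 * pi * exp 1)) ^ k) *
        complex_of_real ((-1) ^ (((r - 1) * k + 1) div 2) *
          (2 * sqrt (real ((r - 1) * k)) / sqrt (2 * pi)) *
          (real ((r - 1) * k) / (2 * pi * exp 1)) ^ ((r - 1) * k)) =
        complex_of_real ((- 1) ^ (r div 2 - 1) * (2 * real k / pi)
                   * real (r - 1) powr (real ((r - 1) * k) - 1 / 2)
                   * (real k / (2 * pi * exp 1)) ^ (r * k))"
      unfolding n_def [symmetric] X_def [symmetric] eq [symmetric]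
      by (simp only: of_real_mult of_real_divide of_real_1 of_real_of_nat_eq)
  qed
  finally show "(\<lambda>k::nat. 1 / of_nat (r - 1) * riemann_zeta (- of_nat k)
                       * riemann_zeta (- of_nat ((r - 1) * k))) \<sim>[odd_at_top] \<dots>" .
qed

end
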